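(* In the non-exponential discounting problem with $J(\tau;t)=\mathbb E_t[D(\tau-t)g(X_\tau)]$ described in the context (under its assumptions (i)–(iv)), the limit $\rho^{(\infty)}=\lim_{n\to\infty}\rho^{(n)}$ of the $n$-th order naive times is the sophisticated solution, i.e. $\rho^{(\infty)}=\tau_*=\rho^*$.
   Context: Setting. $\mathbb T=[0,+\infty)$, $T=+\infty$. The $d$-dimensional state process solves $dX_s=b(s,X_s)ds+\sigma(s,X_s)dB_s$, $X_0=x_0$, with $x_0$ fixed, $b,\sigma$ given deterministic functions and $B$ a standard Brownian motion on a probability space $(\Omega,\mathcal F,\mathbb P)$. The filtration $\{\mathcal F_t\}$ is the $\mathbb P$-augmented natural filtration of $B$ (satisfying the usual conditions). $\mathcal T(\rho)$ is the set of stopping times $\tau\ge\rho$. $\mathbb E_t=\mathbb E[\cdot|\mathcal F_t]$. For $t\ge0$ and $\tau\in\mathcal T(t)$, $J(\tau;t)=\mathbb E_t[D(\tau-t)g(X_\tau)]$, where $D:\mathbb R^+\to(0,1]$ is decreasing with $D(0)=1$ and $g:\mathbb R^d\to\mathbb R^+$. Assumptions: (i) the SDE admits a unique strong solution, which is strongly Markovian; (ii) $g$ is nonnegative and continuous; (iii) $D(t)D(s)\le D(t+s)$ for all $s,t\ge0$; (iv) $Y_t:=D(t)g(X_t)$ is of class $\mathbf D$, i.e. $\{Y_\tau\}_{\tau\in\mathcal T(0)}$ is uniformly integrable. Stopping times that are a.s. equal are identified and inequalities between them are a.s. For $\rho\in\mathcal T(0)$, $F(\rho)=\inf\{t<\rho:\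 J(t;t)>J(\tau;t)\ \text{for all stopping times }\tau\text{ with }t<\tau\le\rho\}\wedge\rho$, read $\omega$ by $\omega$: a time $t$ with $t<\rho(\omega)$ is in the set iff $J(t;t)(\omega)>J(\tau;t)(\omega)$ for every $\tau\in\mathcal T(t)$ with $\tau\le\rho\vee t$ and $\tau(\omega)>t$. $F(\rho)$ is a stopping time. Naive times: $\rho^{(0)}=+\infty$, $\rho^{(n)}=F(\rho^{(n-1)})$ for $n\ge1$, a decreasing sequence with limit $\rho^{(\infty)}$. A stopping time $\tau$ is approachable if $F(\tau)=\tau$; $\tau_*$ is the essential supremum of all approachable times. A set $\mathbb B\subset\mathcal T(0)$ is admissible if (i) $T\in\mathbb B$; (ii) $\rho\in\mathbb B$ implies $F(\rho)\in\mathbb B$; (iii) the essential infimum of any totally ordered subset of $\mathbb B$ belongs to $\mathbb B$. $\mathbb D$ is the intersection of all admissible sets and $\rho^*$ its essential infimum. The sophisticated time (sophisticated solution) is $\tau_*=\rho^*$ (these coincide).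
   Formalization: J(τ;t) is only defined up to null sets, so F(ρ) read ω by ω is ill-defined; versions are assumed coherent: right values at stopping times, "for all τ" and "a.s." exchangeable there, F's infimum reached along stopping times. The payoff at τ=∞ is a limsup. *)

theory Defs
  imports "HOL-Probability.Probability"
begin

text \<open>Processes are indexed by \<^typ>\<open>real\<close> and used only at indices \<open>\<ge> 0\<close>. Filtrations and stopping
  times are indexed by \<^typ>\<open>ennreal\<close>, so that stopping times may take the value \<open>T = \<infinity>\<close>.\<close>

section \<open>Brownian motion and its augmented filtration\<close>

definition brownian_motion :: "'w measure \<Rightarrow> (real \<Rightarrow> 'w \<Rightarrow> real ^ 'm::finite) \<Rightarrow> bool" where
  "brownian_motion M B \<longleftrightarrow>
     (\<forall>t\<ge>0. B t \<in> borel_measurable M) \<and>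
     (AE \<omega> in M. B 0 \<omega> = 0) \<and>
     (\<forall>\<omega>\<in>space M. continuous_on {0..} (\<lambda>t. B t \<omega>)) \<and>
     (\<forall>s t. 0 \<le> s \<and> s < t \<longrightarrow>
        distributed M lborel (\<lambda>\<omega>. B t \<omega> - B s \<omega>)
          (\<lambda>x. \<Prod>i\<in>UNIV. ennreal (normal_density 0 (sqrt (t - s)) (x $ i)))) \<and>
     (\<forall>(n::nat) u. 0 \<le> u 0 \<and> (\<forall>i<n. u i \<le> u (Suc i)) \<longrightarrow>
        prob_space.indep_vars M (\<lambda>_. borel) (\<lambda>i \<omega>. B (u (Suc i)) \<omega> - B (u i) \<omega>) {..<n})"

definition aug_filtration ::
    "'w measure \<Rightarrow> (real \<Rightarrow> 'w \<Rightarrow> 'b::topological_space) \<Rightarrow> ennreal \<Rightarrow> 'w measure" where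
  "aug_filtration M B t =
     sigma (space M)
       ({B s -` A \<inter> space M | s A. 0 \<le> s \<and> ennreal s \<le> t \<and> A \<in> sets borel} \<union> null_sets M)"

definition usual_conditions :: "'w measure \<Rightarrow> (ennreal \<Rightarrow> 'w measure) \<Rightarrow> bool" where
  "usual_conditions M G \<longleftrightarrow>
     complete_measure M \<and> null_sets M \<subseteq> sets (G 0) \<and>
     (\<forall>t<\<infinity>. sets (G t) = (\<Inter>u\<in>{t<..}. sets (G u)))"

section \<open>The It\^o integral\<close>

definition progressively_measurable ::
    "(ennreal \<Rightarrow> 'w measure) \<Rightarrow> (real \<Rightarrow> 'w \<Rightarrow> 'b::topological_space) \<Rightarrow> bool" where
  "progressively_measurable G H \<longleftrightarrow>
     (\<forall>t\<ge>0. (\<lambda>(s, \<omega>). H s \<omega>) \<in> borel_measurable (restrict_space borel {0..t} \<Otimes>\<^sub>M G (ennreal t)))"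

text \<open>A triple \<open>(n, s, \<xi>)\<close> stands for the simple process
  \<open>\<Sum>i<n. 1\<^bsub>(s i, s (i+1)]\<^esub> \<xi> i\<close>.\<close>

definition simple_process ::
    "'w measure \<Rightarrow> (ennreal \<Rightarrow> 'w measure) \<Rightarrow> nat \<Rightarrow> (nat \<Rightarrow> real) \<Rightarrow>
       (nat \<Rightarrow> 'w \<Rightarrow> 'b::real_normed_vector) \<Rightarrow> bool" where
  "simple_process M G n s \<xi> \<longleftrightarrow>
     0 \<le> s 0 \<and> (\<forall>i<n. s i \<le> s (Suc i)) \<and>
     (\<forall>i<n. \<xi> i \<in> borel_measurable (G (ennreal (s i))) \<and> (\<exists>C. \<forall>\<omega>\<in>space M. norm (\<xi> i \<omega>) \<le> C))"

definition simple_eval ::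
    "nat \<Rightarrow> (nat \<Rightarrow> real) \<Rightarrow> (nat \<Rightarrow> 'w \<Rightarrow> 'b::real_vector) \<Rightarrow> real \<Rightarrow> 'w \<Rightarrow> 'b" where
  "simple_eval n s \<xi> u \<omega> = (\<Sum>i<n. indicator {s i<..s (Suc i)} u *\<^sub>R \<xi> i \<omega>)"

definition simple_integral ::
    "(real \<Rightarrow> 'w \<Rightarrow> real ^ 'm::finite) \<Rightarrow> nat \<Rightarrow> (nat \<Rightarrow> real) \<Rightarrow>
       (nat \<Rightarrow> 'w \<Rightarrow> real ^ 'm ^ 'd::finite) \<Rightarrow> real \<Rightarrow> 'w \<Rightarrow> real ^ 'd" where
  "simple_integral B n s \<xi> t \<omega> =
     (\<Sum>i<n. \<xi> i \<omega> *v (B (min (s (Suc i)) t) \<omega> - B (min (s i) t) \<omega>))"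

text \<open>\<open>I\<close> is (a version of) the process \<open>t \<mapsto> \<integral>\<^sub>0\<^sup>t H dB\<close>, for progressive \<open>H\<close> with locally square
  integrable paths: the continuous adapted limit in probability of the integrals of simple
  processes approximating \<open>H\<close>.\<close>

definition is_ito_integral ::
    "'w measure \<Rightarrow> (real \<Rightarrow> 'w \<Rightarrow> real ^ 'm::finite) \<Rightarrow> (real \<Rightarrow> 'w \<Rightarrow> real ^ 'm ^ 'd::finite) \<Rightarrow>
       (real \<Rightarrow> 'w \<Rightarrow> real ^ 'd) \<Rightarrow> bool" where
  "is_ito_integral M B H I \<longleftrightarrow>
     progressively_measurable (aug_filtration M B) H \<and>
     (AE \<omega> in M. \<forall>t\<ge>0. (\<integral>\<^sup>+u\<in>{0..t}. ennreal ((norm (H u \<omega>))\<^sup>2) \<partial>lborel) < \<infinity>) \<and>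
     (\<forall>\<omega>\<in>space M. continuous_on {0..} (\<lambda>t. I t \<omega>)) \<and>
     (\<forall>t\<ge>0. I t \<in> borel_measurable (aug_filtration M B (ennreal t))) \<and>
     (\<exists>n s \<xi>.
        (\<forall>k::nat. simple_process M (aug_filtration M B) (n k) (s k) (\<xi> k)) \<and>
        (\<forall>t\<ge>0. \<forall>\<epsilon>>0.
           (\<lambda>k. measure M {\<omega>\<in>space M.
              (\<integral>\<^sup>+u\<in>{0..t}. ennreal ((norm (simple_eval (n k) (s k) (\<xi> k) u \<omega> - H u \<omega>))\<^sup>2) \<partial>lborel)
                > ennreal \<epsilon>}) \<longlonglongrightarrow> 0) \<and>
        (\<forall>t\<ge>0. \<forall>\<epsilon>>0.
           (\<lambda>k. measure M {\<omega>\<in>space M.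
              norm (simple_integral B (n k) (s k) (\<xi> k) t \<omega> - I t \<omega>) > \<epsilon>}) \<longlonglongrightarrow> 0))"

section \<open>The state equation\<close>

definition strong_solution ::
    "'w measure \<Rightarrow> (real \<Rightarrow> 'w \<Rightarrow> real ^ 'm::finite) \<Rightarrow> (real \<Rightarrow> real ^ 'd::finite \<Rightarrow> real ^ 'd) \<Rightarrow>
       (real \<Rightarrow> real ^ 'd \<Rightarrow> real ^ 'm ^ 'd) \<Rightarrow> real ^ 'd \<Rightarrow> (real \<Rightarrow> 'w \<Rightarrow> real ^ 'd) \<Rightarrow> bool" where
  "strong_solution M B b \<sigma> x\<^sub>0 X \<longleftrightarrow>
     (\<forall>t\<ge>0. X t \<in> borel_measurable (aug_filtration M B (ennreal t))) \<and>
     (\<forall>\<omega>\<in>space M. continuous_on {0..} (\<lambda>t. X t \<omega>)) \<and>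
     (AE \<omega> in M. X 0 \<omega> = x\<^sub>0) \<and>
     (AE \<omega> in M. \<forall>t\<ge>0. set_integrable lborel {0..t} (\<lambda>s. b s (X s \<omega>))) \<and>
     (\<exists>I. is_ito_integral M B (\<lambda>s \<omega>. \<sigma> s (X s \<omega>)) I \<and>
        (AE \<omega> in M. \<forall>t\<ge>0. X t \<omega> = x\<^sub>0 + (LINT s:{0..t}|lborel. b s (X s \<omega>)) + I t \<omega>))"

definition unique_strong_solution ::
    "'w measure \<Rightarrow> (real \<Rightarrow> 'w \<Rightarrow> real ^ 'm::finite) \<Rightarrow> (real \<Rightarrow> real ^ 'd::finite \<Rightarrow> real ^ 'd) \<Rightarrow>
       (real \<Rightarrow> real ^ 'd \<Rightarrow> real ^ 'm ^ 'd) \<Rightarrow> real ^ 'd \<Rightarrow> (real \<Rightarrow> 'w \<Rightarrow> real ^ 'd) \<Rightarrow> bool" where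
  "unique_strong_solution M B b \<sigma> x\<^sub>0 X \<longleftrightarrow>
     strong_solution M B b \<sigma> x\<^sub>0 X \<and>
     (\<forall>X'. strong_solution M B b \<sigma> x\<^sub>0 X' \<longrightarrow> (AE \<omega> in M. \<forall>t\<ge>0. X' t \<omega> = X t \<omega>))"

abbreviation sigma_at ::
    "'w measure \<Rightarrow> (ennreal \<Rightarrow> 'w measure) \<Rightarrow> ('w \<Rightarrow> ennreal) \<Rightarrow> 'w measure" where
  "sigma_at M G \<tau> \<equiv> filtration.pre_sigma (space M) G \<tau>"

text \<open>The coefficients depend on time, so the conditioning at \<open>\<tau>\<close> is on the pair \<open>(\<tau>, X\<^sub>\<tau>)\<close>. The event
  \<open>{\<tau> = \<infinity>}\<close>, where \<^const>\<open>enn2real\<close> returns 0, is excluded throughout.\<close>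

definition strongly_markovian ::
    "'w measure \<Rightarrow> (ennreal \<Rightarrow> 'w measure) \<Rightarrow> (real \<Rightarrow> 'w \<Rightarrow> 'x::topological_space) \<Rightarrow> bool" where
  "strongly_markovian M G X \<longleftrightarrow>
     (\<forall>\<tau> u A. stopping_time G \<tau> \<and> 0 \<le> u \<and> A \<in> sets borel \<longrightarrow>
       (let E = {\<omega>\<in>space M. \<tau> \<omega> < \<infinity> \<and> X (enn2real (\<tau> \<omega>) + u) \<omega> \<in> A} in
        AE \<omega> in M. \<tau> \<omega> < \<infinity> \<longrightarrow>
          nn_cond_exp M (sigma_at M G \<tau>) (indicator E) \<omega> =
          nn_cond_exp M (vimage_algebra (space M) (\<lambda>\<omega>. (\<tau> \<omega>, X (enn2real (\<tau> \<omega>)) \<omega>)) (borel \<Otimes>\<^sub>M borel))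
            (indicator E) \<omega>))"

section \<open>The reward\<close>

text \<open>\<open>reward D g X t u \<omega>\<close> is \<open>D(u - t) g(X\<^sub>u)(\<omega>)\<close>, for \<open>t < \<infinity>\<close> and \<open>t \<le> u\<close>. At \<open>u = T = \<infinity>\<close> it is the limit
  superior of the reward of stopping at finite times.\<close>

definition reward ::
    "(real \<Rightarrow> real) \<Rightarrow> ('x \<Rightarrow> real) \<Rightarrow> (real \<Rightarrow> 'w \<Rightarrow> 'x) \<Rightarrow> ennreal \<Rightarrow> ennreal \<Rightarrow> 'w \<Rightarrow> ennreal" where
  "reward D g X t u \<omega> =
     (if u = \<infinity> then Limsup at_top (\<lambda>s. ennreal (D (s - enn2real t) * g (X s \<omega>)))
      else ennreal (D (enn2real u - enn2real t) * g (X (enn2real u) \<omega>)))"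

definition discount_function :: "(real \<Rightarrow> real) \<Rightarrow> bool" where
  "discount_function D \<longleftrightarrow> (\<forall>t\<ge>0. 0 < D t \<and> D t \<le> 1) \<and> antimono_on {0..} D \<and> D 0 = 1"

text \<open>Inequalities between stopping times are almost sure.\<close>

definition stopping_times ::
    "'w measure \<Rightarrow> (ennreal \<Rightarrow> 'w measure) \<Rightarrow> ('w \<Rightarrow> ennreal) \<Rightarrow> ('w \<Rightarrow> ennreal) set" where
  "stopping_times M G \<rho> = {\<tau>. stopping_time G \<tau> \<and> (AE \<omega> in M. \<rho> \<omega> \<le> \<tau> \<omega>)}"

abbreviation all_stopping_times ::
    "'w measure \<Rightarrow> (ennreal \<Rightarrow> 'w measure) \<Rightarrow> ('w \<Rightarrow> ennreal) set" where
  "all_stopping_times M G \<equiv> stopping_times M G (\<lambda>_. 0)"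

definition class_D ::
    "'w measure \<Rightarrow> (ennreal \<Rightarrow> 'w measure) \<Rightarrow> (ennreal \<Rightarrow> 'w \<Rightarrow> ennreal) \<Rightarrow> bool" where
  "class_D M G Y \<longleftrightarrow>
     (\<forall>\<epsilon>>0. \<exists>K::real. \<forall>\<tau>\<in>all_stopping_times M G.
        (\<integral>\<^sup>+\<omega>. Y (\<tau> \<omega>) \<omega> * indicator {\<omega>. Y (\<tau> \<omega>) \<omega> > ennreal K} \<omega> \<partial>M) \<le> ennreal \<epsilon>)"

section \<open>The map \<open>F\<close>\<close>

text \<open>\<open>J \<tau> t \<omega>\<close> is the value at \<open>\<omega>\<close> of a version of \<open>\<E>\<^sub>t[D(\<tau> - t) g(X\<^sub>\<tau>)]\<close>; see
  \<open>versions\<close> below.\<close>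

type_synonym 'w criterion = "('w \<Rightarrow> ennreal) \<Rightarrow> ennreal \<Rightarrow> 'w \<Rightarrow> ennreal"

definition stop_set ::
    "'w measure \<Rightarrow> (ennreal \<Rightarrow> 'w measure) \<Rightarrow> 'w criterion \<Rightarrow> ('w \<Rightarrow> ennreal) \<Rightarrow> 'w \<Rightarrow> ennreal set" where
  "stop_set M G J \<rho> \<omega> =
     {t. t < \<rho> \<omega> \<and>
         (\<forall>\<tau>\<in>stopping_times M G (\<lambda>_. t).
            (AE \<omega>' in M. \<tau> \<omega>' \<le> max (\<rho> \<omega>') t) \<and> t < \<tau> \<omega> \<longrightarrow> J (\<lambda>_. t) t \<omega> > J \<tau> t \<omega>)}"

definition F_map ::
    "'w measure \<Rightarrow> (ennreal \<Rightarrow> 'w measure) \<Rightarrow> 'w criterion \<Rightarrow> ('w \<Rightarrow> ennreal) \<Rightarrow> 'w \<Rightarrow> ennreal" where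
  "F_map M G J \<rho> \<omega> = min (Inf (stop_set M G J \<rho> \<omega>)) (\<rho> \<omega>)"

definition versions ::
    "'w measure \<Rightarrow> (ennreal \<Rightarrow> 'w measure) \<Rightarrow> (real \<Rightarrow> real) \<Rightarrow> ('x \<Rightarrow> real) \<Rightarrow> (real \<Rightarrow> 'w \<Rightarrow> 'x) \<Rightarrow>
       'w criterion \<Rightarrow> bool" where
  "versions M G D g X J \<longleftrightarrow>
     (\<forall>t<\<infinity>. \<forall>\<tau>\<in>stopping_times M G (\<lambda>_. t).
        AE \<omega> in M. J \<tau> t \<omega> = nn_cond_exp M (G t) (\<lambda>\<omega>. reward D g X t (\<tau> \<omega>) \<omega>) \<omega>)"

text \<open>Each \<open>J \<tau> t\<close> is determined only up to a null set, whereas \<^const>\<open>stop_set\<close> evaluates uncountably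
  many of them at the same \<open>\<omega>\<close>; for an arbitrary family of versions that set carries no information.
  The following condition restricts the choice of versions only. It says that null
  sets can be ignored when \<^const>\<open>stop_set\<close> is evaluated at a random time \<open>t = \<sigma>(\<omega>)\<close>:
  \<^enum> the process \<open>t \<mapsto> J (\<tau> \<or> t) t\<close> takes at a stopping time \<open>\<sigma>\<close> the value
    \<open>\<E>[D(\<tau> \<or> \<sigma> - \<sigma>) g(X\<^bsub>\<tau> \<or> \<sigma>\<^esub>) | \<F>\<^sub>\<sigma>]\<close> (as the optional version does);
  \<^enum> if each single inequality holds almost surely on \<open>A\<close> at \<open>\<sigma>\<close>, then almost surely on \<open>A\<close> they all
    hold at once (the converse is automatic);
  \<^enum> \<open>F(\<rho>)\<close> is a stopping time, and its infimum is reached along stopping times (as optional section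
    gives for an optional set).\<close>

definition coherent_versions ::
    "'w measure \<Rightarrow> (ennreal \<Rightarrow> 'w measure) \<Rightarrow> (real \<Rightarrow> real) \<Rightarrow> ('x \<Rightarrow> real) \<Rightarrow> (real \<Rightarrow> 'w \<Rightarrow> 'x) \<Rightarrow>
       'w criterion \<Rightarrow> bool" where
  "coherent_versions M G D g X J \<longleftrightarrow>
     versions M G D g X J \<and>
     (\<forall>\<sigma> \<tau>. stopping_time G \<sigma> \<and> stopping_time G \<tau> \<longrightarrow>
        (AE \<omega> in M. \<sigma> \<omega> < \<infinity> \<longrightarrow>
           J (\<lambda>\<omega>'. max (\<tau> \<omega>') (\<sigma> \<omega>)) (\<sigma> \<omega>) \<omega> =
           nn_cond_exp M (sigma_at M G \<sigma>) (\<lambda>\<omega>'. reward D g X (\<sigma> \<omega>') (max (\<tau> \<omega>') (\<sigma> \<omega>')) \<omega>') \<omega>)) \<and>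
     (\<forall>\<rho> \<sigma> A. stopping_time G \<rho> \<and> stopping_time G \<sigma> \<and> A \<in> sets (sigma_at M G \<sigma>) \<and>
        (\<forall>\<tau>. stopping_time G \<tau> \<and> (AE \<omega> in M. \<tau> \<omega> \<le> \<rho> \<omega>) \<longrightarrow>
           (AE \<omega> in M. \<omega> \<in> A \<and> \<sigma> \<omega> < \<tau> \<omega> \<longrightarrow>
              J (\<lambda>_. \<sigma> \<omega>) (\<sigma> \<omega>) \<omega> > J (\<lambda>\<omega>'. max (\<tau> \<omega>') (\<sigma> \<omega>)) (\<sigma> \<omega>) \<omega>)) \<longrightarrow>
        (AE \<omega> in M. \<omega> \<in> A \<and> \<sigma> \<omega> < \<rho> \<omega> \<longrightarrow> \<sigma> \<omega> \<in> stop_set M G J \<rho> \<omega>)) \<and>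
     (\<forall>\<rho>. stopping_time G \<rho> \<longrightarrow>
        stopping_time G (F_map M G J \<rho>) \<and>
        (\<exists>\<sigma>::nat \<Rightarrow> 'w \<Rightarrow> ennreal. (\<forall>k. stopping_time G (\<sigma> k)) \<and>
           (AE \<omega> in M. (\<forall>k. \<sigma> k \<omega> < \<rho> \<omega> \<longrightarrow> \<sigma> k \<omega> \<in> stop_set M G J \<rho> \<omega>) \<and>
              F_map M G J \<rho> \<omega> = min (INF k. \<sigma> k \<omega>) (\<rho> \<omega>))))"

section \<open>Naive and sophisticated times\<close>

primrec naive_time ::
    "'w measure \<Rightarrow> (ennreal \<Rightarrow> 'w measure) \<Rightarrow> 'w criterion \<Rightarrow> nat \<Rightarrow> 'w \<Rightarrow> ennreal" where
  "naive_time M G J 0 = (\<lambda>_. \<infinity>)"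
| "naive_time M G J (Suc n) = F_map M G J (naive_time M G J n)"

definition naive_limit ::
    "'w measure \<Rightarrow> (ennreal \<Rightarrow> 'w measure) \<Rightarrow> 'w criterion \<Rightarrow> 'w \<Rightarrow> ennreal" where
  "naive_limit M G J \<omega> = lim (\<lambda>n. naive_time M G J n \<omega>)"

definition is_ess_sup :: "'w measure \<Rightarrow> ('w \<Rightarrow> ennreal) set \<Rightarrow> ('w \<Rightarrow> ennreal) \<Rightarrow> bool" where
  "is_ess_sup M S \<phi> \<longleftrightarrow>
     \<phi> \<in> borel_measurable M \<and> (\<forall>\<tau>\<in>S. AE \<omega> in M. \<tau> \<omega> \<le> \<phi> \<omega>) \<and>
     (\<forall>\<psi>\<in>borel_measurable M. (\<forall>\<tau>\<in>S. AE \<omega> in M. \<tau> \<omega> \<le> \<psi> \<omega>) \<longrightarrow> (AE \<omega> in M. \<phi> \<omega> \<le> \<psi> \<omega>))"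

definition is_ess_inf :: "'w measure \<Rightarrow> ('w \<Rightarrow> ennreal) set \<Rightarrow> ('w \<Rightarrow> ennreal) \<Rightarrow> bool" where
  "is_ess_inf M S \<phi> \<longleftrightarrow>
     \<phi> \<in> borel_measurable M \<and> (\<forall>\<tau>\<in>S. AE \<omega> in M. \<phi> \<omega> \<le> \<tau> \<omega>) \<and>
     (\<forall>\<psi>\<in>borel_measurable M. (\<forall>\<tau>\<in>S. AE \<omega> in M. \<psi> \<omega> \<le> \<tau> \<omega>) \<longrightarrow> (AE \<omega> in M. \<psi> \<omega> \<le> \<phi> \<omega>))"

definition approachable_times ::
    "'w measure \<Rightarrow> (ennreal \<Rightarrow> 'w measure) \<Rightarrow> 'w criterion \<Rightarrow> ('w \<Rightarrow> ennreal) set" where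
  "approachable_times M G J =
     {\<tau>\<in>all_stopping_times M G. AE \<omega> in M. F_map M G J \<tau> \<omega> = \<tau> \<omega>}"

text \<open>All versions of an essential infimum must belong to \<open>\<B>\<close>; for singletons this makes \<open>\<B>\<close> closed
  under almost sure equality.\<close>

definition admissible ::
    "'w measure \<Rightarrow> (ennreal \<Rightarrow> 'w measure) \<Rightarrow> 'w criterion \<Rightarrow> ('w \<Rightarrow> ennreal) set \<Rightarrow> bool" where
  "admissible M G J \<B> \<longleftrightarrow>
     \<B> \<subseteq> all_stopping_times M G \<and>
     (\<lambda>_. \<infinity>) \<in> \<B> \<and>
     (\<forall>\<rho>\<in>\<B>. F_map M G J \<rho> \<in> \<B>) \<and>
     (\<forall>C \<phi>. C \<subseteq> \<B> \<and>
        (\<forall>\<rho>\<in>C. \<forall>\<rho>'\<in>C. (AE \<omega> in M. \<rho> \<omega> \<le> \<rho>' \<omega>) \<or> (AE \<omega> in M. \<rho>' \<omega> \<le> \<rho> \<omega>)) \<and>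
        is_ess_inf M C \<phi> \<longrightarrow> \<phi> \<in> \<B>)"

definition least_admissible ::
    "'w measure \<Rightarrow> (ennreal \<Rightarrow> 'w measure) \<Rightarrow> 'w criterion \<Rightarrow> ('w \<Rightarrow> ennreal) set" where
  "least_admissible M G J = \<Inter>{\<B>. admissible M G J \<B>}"

text \<open>On a probability space, every set of measurable functions has an essential supremum and an
  essential infimum, unique up to almost sure equality; the choices below select a version.\<close>

definition tau_star ::
    "'w measure \<Rightarrow> (ennreal \<Rightarrow> 'w measure) \<Rightarrow> 'w criterion \<Rightarrow> 'w \<Rightarrow> ennreal" where
  "tau_star M G J = (SOME \<phi>. is_ess_sup M (approachable_times M G J) \<phi>)"

definition rho_star ::
    "'w measure \<Rightarrow> (ennreal \<Rightarrow> 'w measure) \<Rightarrow> 'w criterion \<Rightarrow> 'w \<Rightarrow> ennreal" where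
  "rho_star M G J = (SOME \<phi>. is_ess_inf M (least_admissible M G J) \<phi>)"

end

theory Submission
  imports Defs
begin

text \<open>Write \<open>\<rho>\<^sub>\<infinity>\<close> for the limit of the naive times. The map \<open>F\<close> is monotone (a smaller horizon leaves fewer
alternatives, so stopping is preferred more often) and \<open>F(\<rho>) \<le> \<rho>\<close>. Hence every approachable time lies
below every naive time and so below \<open>\<rho>\<^sub>\<infinity>\<close>, while every admissible set contains all naive times and
their infimum \<open>\<rho>\<^sub>\<infinity>\<close>. If moreover \<open>F(\<rho>\<^sub>\<infinity>) = \<rho>\<^sub>\<infinity>\<close>, then \<open>\<rho>\<^sub>\<infinity>\<close> is the largest approachable time, and the
stopping times above \<open>\<rho>\<^sub>\<infinity>\<close> form an admissible set, so that \<open>\<rho>\<^sub>\<infinity>\<close> is also the essential infimum of the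
least admissible set. Everything therefore rests on \<open>F(\<rho>\<^sub>\<infinity>) = \<rho>\<^sub>\<infinity>\<close>, which is \<open>naive_limit_approachable\<close>.

Suppose it fails. Then there is a stopping time \<open>\<sigma>\<close>, before \<open>\<rho>\<^sub>\<infinity>\<close> with positive probability, at which
stopping is strictly better than any continuation up to \<open>\<rho>\<^sub>\<infinity>\<close>, in particular better than \<open>\<rho>\<^sub>\<infinity>\<close> itself.
On the other hand, no time before \<open>\<rho>\<^sub>\<infinity> \<le> F(\<rho>\<^sup>(\<^sup>n\<^sup>))\<close> is a time at which stopping beats all continuations
up to \<open>\<rho>\<^sup>(\<^sup>n\<^sup>)\<close>: each such self has a strictly later stopping time that is at least as good. Decreasing
impatience makes the self at \<open>\<sigma>\<close> agree with this choice of a later self, since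
\<open>D(\<tau> - \<sigma>) \<ge> D(t - \<sigma>) D(\<tau> - t)\<close>. Stringing such improvements together (\<open>continuation_until_F\<close>), one arrives
at a stopping time \<open>\<tau>\<^sub>n\<close> between \<open>\<rho>\<^sub>\<infinity>\<close> and \<open>\<rho>\<^sup>(\<^sup>n\<^sup>)\<close> that is, for the self at \<open>\<sigma>\<close>, at least as good as
stopping. As \<open>n\<close> grows, \<open>\<tau>\<^sub>n\<close> tends to \<open>\<rho>\<^sub>\<infinity>\<close> and the reverse Fatou lemma, available because of class
\<open>\<^bold>D\<close>, shows that \<open>\<rho>\<^sub>\<infinity>\<close> is at least as good as stopping: a contradiction.

The delicate point is the passage to the limit within the string of improvements, which may be
transfinite. It is organised by an ordering principle, which only asks that increasing sequences have
upper bounds. The discount function may jump, so the discount from \<open>\<sigma>\<close> to an increasing limit of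
stopping times can be smaller than the limit of the discounts. The remedy is to keep track not of the
discount \<open>D(\<tau> - \<sigma>)\<close> but of the product \<open>W \<le> D(\<tau> - \<sigma>)\<close> of the discount factors of the single steps. If
\<open>D(0+) = 1\<close> the bound on \<open>W\<close> passes to the limit; if \<open>D(0+) < 1\<close>, infinitely many proper steps force
\<open>W = 0\<close> and the bound is trivial (\<open>discounted_weight_limit\<close>).\<close>

section \<open>An ordering principle\<close>

text \<open>The principle of Brezis and Browder. Going at each step at least half of the way to the supremum of what
is still attainable exhausts the possible gain after countably many steps, which replaces a transfinite iteration.\<close>

lemma ordering_principle:
  fixes S :: "'a set" and le :: "'a \<Rightarrow> 'a \<Rightarrow> bool" and f :: "'a \<Rightarrow> real"
  assumes x0: "x0 \<in> S"
    and refl: "\<And>x. x \<in> S \<Longrightarrow> le x x"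
    and trans: "\<And>x y z. \<lbrakk>x \<in> S; y \<in> S; z \<in> S; le x y; le y z\<rbrakk> \<Longrightarrow> le x z"
    and mono: "\<And>x y. \<lbrakk>x \<in> S; y \<in> S; le x y\<rbrakk> \<Longrightarrow> f x \<le> f y"
    and bdd: "\<And>x. x \<in> S \<Longrightarrow> f x \<le> C"
    and chain: "\<And>x. (\<And>k::nat. x k \<in> S) \<Longrightarrow> (\<And>k. le (x k) (x (Suc k))) \<Longrightarrow> \<exists>y\<in>S. \<forall>k. le (x k) y"
  obtains m where "m \<in> S" "le x0 m" "\<And>y. y \<in> S \<Longrightarrow> le m y \<Longrightarrow> f y = f m"
proof -
  define s where "s x = (SUP y\<in>{y\<in>S. le x y}. f y)" for x
  have bddA: "bdd_above (f ` {y\<in>S. le x y})" for x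
    using bdd by (intro bdd_aboveI[of _ C]) auto
  have s_upper: "f y \<le> s x" if "y \<in> S" "le x y" for x y
    unfolding s_def using that by (intro cSUP_upper[OF _ bddA]) auto
  have step: "\<exists>y. y \<in> S \<and> le x y \<and> (f x + s x) / 2 \<le> f y" if "x \<in> S" for x
  proof (cases "f x < s x")
    case True
    then have "(f x + s x) / 2 < s x" by simp
    then have "\<exists>y\<in>{y\<in>S. le x y}. (f x + s x) / 2 < f y"
      using less_cSUP_iff[OF _ bddA[of x], of "(f x + s x) / 2"] that refl[OF that]
      unfolding s_def[of x, symmetric] by blast
    then show ?thesis by (auto intro: less_imp_le)
  next
    case False
    then show ?thesis using that refl[OF that] s_upper[OF that refl[OF that]] by auto
  qed
  have "\<exists>x. \<forall>k. (x k \<in> S \<and> (k = 0 \<longrightarrow> x k = x0)) \<and>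
      (le (x k) (x (Suc k)) \<and> (f (x k) + s (x k)) / 2 \<le> f (x (Suc k)))"
    by (rule dependent_nat_choice) (use x0 step in auto)
  then obtain x where x: "\<And>k. x k \<in> S" "x 0 = x0" "\<And>k. le (x k) (x (Suc k))"
      "\<And>k. (f (x k) + s (x k)) / 2 \<le> f (x (Suc k))"
    by blast
  obtain m where m: "m \<in> S" "\<And>k. le (x k) m"
    using chain[of x] x by blast
  have "incseq (\<lambda>k. f (x k))"
    using x by (intro incseq_SucI mono) auto
  then obtain L where L: "(\<lambda>k. f (x k)) \<longlonglongrightarrow> L"
    using bdd x(1) by (meson incseq_convergent)
  have Lm: "L \<le> f m"
    by (rule LIMSEQ_le_const2[OF L]) (use mono m x in auto)
  show thesis
  proof
    show "m \<in> S" "le x0 m" using m x(2) by metis+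
    fix y assume y: "y \<in> S" "le m y"
    have "f y \<le> 2 * f (x (Suc k)) - f (x k)" for k
      using s_upper[OF y(1) trans[OF x(1) m(1) y(1) m(2) y(2)], of k] x(4)[of k] by simp
    then have "f y \<le> 2 * L - L"
      by (intro LIMSEQ_le_const[of "\<lambda>k. 2 * f (x (Suc k)) - f (x k)"] tendsto_intros
            LIMSEQ_Suc[OF L] L) auto
    then show "f y = f m" using Lm mono[OF m(1) y] by simp
  qed
qed

section \<open>Discounting with decreasing impatience\<close>

locale impatient_discount =
  fixes D :: "real \<Rightarrow> real"
  assumes discount: "discount_function D"
    and impatience: "\<And>s t. 0 \<le> s \<Longrightarrow> 0 \<le> t \<Longrightarrow> D t * D s \<le> D (t + s)"
begin

lemma D_pos: "0 \<le> t \<Longrightarrow> 0 < D t"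
  and D_le_1: "0 \<le> t \<Longrightarrow> D t \<le> 1"
  and D_antimono: "0 \<le> s \<Longrightarrow> s \<le> t \<Longrightarrow> D t \<le> D s"
  and D_0: "D 0 = 1"
  using discount by (auto simp: discount_function_def monotone_on_def)

lemma D_chain:
  assumes "r \<le> s" "s \<le> t"
  shows "ennreal (D (s - r)) * ennreal (D (t - s)) \<le> ennreal (D (t - r))"
proof -
  have "D (t - s) * D (s - r) \<le> D (t - r)"
    using impatience[of "s - r" "t - s"] assms by simp
  then show ?thesis
    using assms D_pos[of "t - s"] D_pos[of "s - r"]
    by (subst ennreal_mult[symmetric]) (auto simp: mult.commute intro!: ennreal_leI)
qed

lemma borel_measurable_D: "(\<lambda>x. D (max 0 x)) \<in> borel_measurable borel"
proof -
  have "mono (\<lambda>x. - D (max 0 x))"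
    by (intro monoI) (auto intro!: D_antimono)
  from borel_measurable_mono[OF this] have "(\<lambda>x. - (- D (max 0 x))) \<in> borel_measurable borel"
    by (rule borel_measurable_uminus)
  then show ?thesis by simp
qed

text \<open>A product of discount factors over increasingly many steps stays below the discount of the total
time even in the limit, although \<open>D\<close> need not be left-continuous. If \<open>c\<close> is the limit of \<open>D\<close> at \<open>0+\<close>,
then splitting the time at \<open>t j\<close> gives the bound up to the factor \<open>c\<close>, which is harmless for \<open>c = 1\<close>. If \<open>c < 1\<close>, every
proper step costs a factor of at most \<open>c\<close>, so infinitely many of them bring the weight down to \<open>0\<close>.\<close>

lemma discounted_weight_limit:
  fixes w :: "nat \<Rightarrow> ennreal"
  assumes t: "incseq t" "t \<longlonglongrightarrow> (l::real)"
    and w: "\<And>i j. i \<le> j \<Longrightarrow> w j \<le> w i * ennreal (D (t j - t i))" and "w 0 \<le> 1"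
  shows "(INF j. w j) \<le> w k * ennreal (D (l - t k))"
proof (cases "\<exists>j\<ge>k. t j = l")
  case True
  then obtain j where "j \<ge> k" "t j = l" by blast
  then show ?thesis using w[of k j] by (meson INF_lower2 UNIV_I)
next
  case False
  have t_le: "t j \<le> l" for j using incseq_le[OF t] .
  have t_less: "t j < l" for j
    using False t_le[of "max j k"] incseqD[OF t(1), of j "max j k"] by (metis max.cobounded1 max.cobounded2 nless_le order_less_le_trans)
  define c where "c = (SUP j. ennreal (D (l - t j)))"
  have c1: "c \<le> 1" unfolding c_def using t_le D_le_1 by (auto intro!: SUP_least)
  have "(INF j. w j) * ennreal (D (l - t j)) \<le> w k * ennreal (D (l - t k))" for j
  proof -
    let ?j = "max j k"
    have "(INF j. w j) * ennreal (D (l - t j)) \<le> w ?j * ennreal (D (l - t ?j))"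
      using incseqD[OF t(1), of j ?j] t_le by (intro mult_mono INF_lower ennreal_leI D_antimono) auto
    also have "\<dots> \<le> w k * ennreal (D (t ?j - t k)) * ennreal (D (l - t ?j))"
      by (intro mult_right_mono w) auto
    also have "\<dots> = w k * (ennreal (D (t ?j - t k)) * ennreal (D (l - t ?j)))"
      by (simp add: mult.assoc)
    also have "\<dots> \<le> w k * ennreal (D (l - t k))"
      using incseqD[OF t(1), of k ?j] t_le by (intro mult_left_mono D_chain) auto
    finally show ?thesis .
  qed
  then have *: "(INF j. w j) * c \<le> w k * ennreal (D (l - t k))"
    unfolding c_def SUP_mult_left_ennreal by (auto intro!: SUP_least)
  show ?thesis
  proof (cases "c = 1")
    case True
    then show ?thesis using * by simp
  next
    case False
    have "(INF j. w j) \<le> w j * c" for j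
    proof -
      obtain m where m: "j \<le> m" "t j < t m"
        using order_tendstoD(1)[OF t(2) t_less[of j]] eventually_ge_at_top[of j]
        by (metis (mono_tags, lifting) eventually_conj eventually_happens' sequentially_bot)
      have "l - (t m - t j) < l" using m by simp
      then obtain n where n: "l - (t m - t j) < t n"
        using order_tendstoD(1)[OF t(2)] by (metis (mono_tags, lifting) eventually_happens' sequentially_bot)
      have "(INF j. w j) \<le> w j * ennreal (D (t m - t j))"
        using w[OF m(1)] by (meson INF_lower2 UNIV_I)
      also have "\<dots> \<le> w j * ennreal (D (l - t n))"
        using m n t_le by (intro mult_left_mono ennreal_leI D_antimono) auto
      also have "\<dots> \<le> w j * c"
        unfolding c_def by (intro mult_left_mono SUP_upper) auto
      finally show ?thesis .
    qed
    then have le: "(INF j. w j) \<le> w j * c" for j .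
    have "(INF j. w j) \<le> 1" using \<open>w 0 \<le> 1\<close> by (meson INF_lower2 UNIV_I)
    then obtain v where v: "(INF j. w j) = ennreal v" "0 \<le> v"
      by (metis ennreal_cases ennreal_one_less_top leD top_greatest)
    obtain d where d: "c = ennreal d" "0 \<le> d" "d < 1"
      using c1 False by (cases c) (auto simp: top_unique ennreal_1[symmetric] simp del: ennreal_1)
    have "v = 0"
    proof (rule ccontr)
      assume "v \<noteq> 0"
      then have "d > 0" using le[of 0] v d by (cases "d = 0") auto
      have "ennreal (v / d) \<le> w j" for j
      proof -
        have "ennreal (v / d) = ennreal v / ennreal d" using v \<open>d > 0\<close> by (simp add: divide_ennreal)
        also have "\<dots> \<le> w j * ennreal d / ennreal d"
          using le[of j] v(1) d(1) by (intro divide_right_mono_ennreal) auto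
        also have "\<dots> = w j" using \<open>d > 0\<close> by (simp add: ennreal_mult_divide_eq)
        finally show ?thesis .
      qed
      then have "ennreal (v / d) \<le> ennreal v" unfolding v(1)[symmetric] by (rule INF_greatest)
      then have "v / d \<le> v" using v by simp
      then have "v \<le> v * d" using \<open>d > 0\<close> by (simp add: field_simps)
      then show False using \<open>v \<noteq> 0\<close> v d by (simp add: mult_le_cancel_left1)
    qed
    then show ?thesis using v by simp
  qed
qed

end

section \<open>Rewards\<close>

text \<open>The reward at time \<open>\<infinity>\<close> is a limit superior over uncountably many times; this reduces its measurability
to a countable operation. Approximation by smaller rationals suffices, because the
decreasing factor \<open>f\<close> is there at least as large, however discontinuous it may be.\<close>

lemma Limsup_at_top_rationals:
  fixes y :: "real \<Rightarrow> real" and f :: "real \<Rightarrow> real"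
  assumes f: "\<And>s t. s \<le> t \<Longrightarrow> r \<le> s \<Longrightarrow> f t \<le> f s" "\<And>s. 0 \<le> f s"
    and y: "continuous_on {0..} y" "\<And>s. 0 \<le> y s"
  shows "Limsup at_top (\<lambda>s. ennreal (f s * y s)) =
    (INF n::nat. SUP q\<in>{q\<in>\<rat>. real n < q}. ennreal (f q * y q))"
proof (rule antisym)
  show "Limsup at_top (\<lambda>s. ennreal (f s * y s)) \<le>
    (INF n::nat. SUP q\<in>{q\<in>\<rat>. real n < q}. ennreal (f q * y q))"
  proof (rule INF_greatest, rule Limsup_bounded)
    fix n :: nat
    let ?S = "SUP q\<in>{q\<in>\<rat>. real n < q}. ennreal (f q * y q)"
    show "\<forall>\<^sub>F s in at_top. ennreal (f s * y s) \<le> ?S"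
      using eventually_gt_at_top[of "max (real n) r"]
    proof eventually_elim
      fix s assume s: "max (real n) r < s"
      have "\<exists>q. q \<in> \<rat> \<and> max (max (real n) r) (s - 1 / Suc k) < q \<and> q < s" for k :: nat
        using Rats_dense_in_real[of "max (max (real n) r) (s - 1 / Suc k)" s] s by auto
      then obtain q where q: "\<And>k. q k \<in> \<rat>" "\<And>k. max (max (real n) r) (s - 1 / Suc k) < q k" "\<And>k. q k < s"
        by metis
      have q': "n < q k" "r < q k" "s - 1 / Suc k < q k" for k using q(2)[of k] by auto
      have "q \<longlonglongrightarrow> s"
      proof (rule tendsto_sandwich)
        show "(\<lambda>k. s - 1 / Suc k) \<longlonglongrightarrow> s"
          using tendsto_diff[OF tendsto_const[of s] LIMSEQ_Suc[OF lim_1_over_n]] by simp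
        show "\<forall>\<^sub>F k in sequentially. s - 1 / Suc k \<le> q k" by (intro always_eventually allI less_imp_le q'(3))
        show "\<forall>\<^sub>F k in sequentially. q k \<le> s" by (intro always_eventually allI less_imp_le q(3))
      qed auto
      then have "(\<lambda>k. y (q k)) \<longlonglongrightarrow> y s"
        using y(1) s q' by (intro continuous_on_tendsto_compose[OF y(1)]) (auto intro!: always_eventually less_imp_le[OF le_less_trans[OF _ q'(1)]])
      then have "(\<lambda>k. ennreal (f s * y (q k))) \<longlonglongrightarrow> ennreal (f s * y s)"
        by (intro tendsto_intros tendsto_ennrealI)
      then show "ennreal (f s * y s) \<le> ?S"
      proof (rule LIMSEQ_le_const2, intro exI[of _ 0] allI impI)
        fix k
        have "ennreal (f s * y (q k)) \<le> ennreal (f (q k) * y (q k))"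
          using f(1)[of "q k" s] q(3)[of k] q'[of k] y(2) by (intro ennreal_leI mult_right_mono) auto
        also have "\<dots> \<le> ?S" using q q' by (intro SUP_upper) auto
        finally show "ennreal (f s * y (q k)) \<le> ?S" .
      qed
    qed
  qed
  show "(INF n::nat. SUP q\<in>{q\<in>\<rat>. real n < q}. ennreal (f q * y q)) \<le>
    Limsup at_top (\<lambda>s. ennreal (f s * y s))"
  proof (rule Limsup_greatest)
    fix P :: "real \<Rightarrow> bool" assume "eventually P at_top"
    then obtain N where N: "\<And>s. s \<ge> N \<Longrightarrow> P s" by (auto simp: eventually_at_top_linorder)
    obtain n :: nat where n: "N \<le> real n" using real_arch_simple by blast
    show "(INF n::nat. SUP q\<in>{q\<in>\<rat>. real n < q}. ennreal (f q * y q)) \<le>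
      (SUP s\<in>Collect P. ennreal (f s * y s))"
      by (rule INF_lower2[of n], simp, rule SUP_subset_mono) (use n N in auto)
  qed
qed

text \<open>Approximation from the left by random times with countably many values; continuity of the paths gives the limit.\<close>

lemma measurable_process_at_random_time:
  fixes y :: "real \<Rightarrow> 'w \<Rightarrow> real"
  assumes y: "\<And>t. 0 \<le> t \<Longrightarrow> y t \<in> borel_measurable M"
    and cont: "\<And>\<omega>. \<omega> \<in> space M \<Longrightarrow> continuous_on {0..} (\<lambda>t. y t \<omega>)"
    and T[measurable]: "T \<in> borel_measurable M" and T0: "\<And>\<omega>. \<omega> \<in> space M \<Longrightarrow> 0 \<le> T \<omega>"
  shows "(\<lambda>\<omega>. y (T \<omega>) \<omega>) \<in> borel_measurable M"
proof (rule borel_measurable_LIMSEQ_metric)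
  let ?T = "\<lambda>n \<omega>. real (nat \<lfloor>T \<omega> * real (Suc n)\<rfloor>) / real (Suc n)"
  show "(\<lambda>\<omega>. y (?T n \<omega>) \<omega>) \<in> borel_measurable M" for n
    by (rule measurable_compose_countable[where f="\<lambda>k. y (real k / real (Suc n))" and g="\<lambda>\<omega>. nat \<lfloor>T \<omega> * real (Suc n)\<rfloor>"])
      (auto intro!: y)
  fix \<omega> assume \<omega>: "\<omega> \<in> space M"
  have "(\<lambda>n. ?T n \<omega>) \<longlonglongrightarrow> T \<omega>"
  proof (rule tendsto_sandwich)
    show "(\<lambda>n. T \<omega> - 1 / Suc n) \<longlonglongrightarrow> T \<omega>"
      using tendsto_diff[OF tendsto_const[of "T \<omega>"] LIMSEQ_Suc[OF lim_1_over_n]] by simp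
    have "T \<omega> - 1 / Suc n \<le> ?T n \<omega>" "?T n \<omega> \<le> T \<omega>" for n
    proof -
      have "real (nat \<lfloor>T \<omega> * real (Suc n)\<rfloor>) = of_int \<lfloor>T \<omega> * real (Suc n)\<rfloor>"
        using T0[OF \<omega>] by (subst of_nat_nat) auto
      moreover have "T \<omega> - 1 / Suc n = (T \<omega> * real (Suc n) - 1) / Suc n"
        by (simp add: field_simps)
      moreover have "T \<omega> = (T \<omega> * real (Suc n)) / Suc n" by simp
      ultimately show "T \<omega> - 1 / Suc n \<le> ?T n \<omega>" "?T n \<omega> \<le> T \<omega>"
        by (metis divide_right_mono of_nat_0_le_iff real_of_int_floor_ge_diff_one)
          (metis \<open>real (nat \<lfloor>T \<omega> * real (Suc n)\<rfloor>) = real_of_int \<lfloor>T \<omega> * real (Suc n)\<rfloor>\<close> \<open>T \<omega> = T \<omega> * real (Suc n) / real (Suc n)\<close> divide_right_mono of_nat_0_le_iff of_int_floor_le)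
    qed
    then show "\<forall>\<^sub>F n in sequentially. T \<omega> - 1 / Suc n \<le> ?T n \<omega>" "\<forall>\<^sub>F n in sequentially. ?T n \<omega> \<le> T \<omega>"
      by auto
  qed auto
  then show "(\<lambda>n. y (?T n \<omega>) \<omega>) \<longlonglongrightarrow> y (T \<omega>) \<omega>"
    using T0[OF \<omega>] by (intro continuous_on_tendsto_compose[OF cont[OF \<omega>]]) auto
qed

lemma enn2real_mono_finite: "x \<le> y \<Longrightarrow> y < \<infinity> \<Longrightarrow> enn2real x \<le> enn2real y"
  by (intro enn2real_mono) auto

context impatient_discount
begin

lemma reward_same: "t < \<infinity> \<Longrightarrow> reward D g X t t \<omega> = ennreal (g (X (enn2real t) \<omega>))"
  by (auto simp: reward_def D_0)

text \<open>Decreasing impatience in the form in which it is used: the self at \<open>s\<close> values a plan at least as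
much as the value that the self at \<open>t\<close> attaches to it, discounted from \<open>t\<close> to \<open>s\<close>.\<close>

lemma reward_impatience:
  assumes le: "s \<le> t" "t \<le> u" "t < \<infinity>" and g: "\<And>x. 0 \<le> g x"
  shows "ennreal (D (enn2real t - enn2real s)) * reward D g X t u \<omega> \<le> reward D g X s u \<omega>"
proof -
  let ?s = "enn2real s" and ?t = "enn2real t"
  let ?d = "ennreal (D (?t - ?s))"
  have st: "?s \<le> ?t" using le by (intro enn2real_mono) auto
  have *: "?d * ennreal (D (v - ?t) * g (X v \<omega>)) \<le> ennreal (D (v - ?s) * g (X v \<omega>))"
    if "?t \<le> v" for v
  proof -
    have "?d * ennreal (D (v - ?t) * g (X v \<omega>)) = (?d * ennreal (D (v - ?t))) * ennreal (g (X v \<omega>))"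
      using D_pos[of "v - ?t"] that g by (simp add: ennreal_mult'' mult.assoc)
    also have "\<dots> \<le> ennreal (D (v - ?s)) * ennreal (g (X v \<omega>))"
      using D_chain[OF st that] by (rule mult_right_mono) auto
    finally show ?thesis using g by (simp add: ennreal_mult'')
  qed
  show ?thesis
  proof (cases "u = \<infinity>")
    case True
    have "?d * Limsup at_top (\<lambda>v. ennreal (D (v - ?t) * g (X v \<omega>))) =
        Limsup at_top (\<lambda>v. ?d * ennreal (D (v - ?t) * g (X v \<omega>)))"
      by (rule Limsup_compose_continuous_mono[symmetric])
        (auto intro!: ennreal_continuous_on_cmult continuous_intros monoI mult_left_mono)
    also have "\<dots> \<le> Limsup at_top (\<lambda>v. ennreal (D (v - ?s) * g (X v \<omega>)))"
      by (rule Limsup_mono) (auto intro!: eventually_mono[OF eventually_ge_at_top[of ?t]] *)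
    finally show ?thesis using True by (simp add: reward_def)
  next
    case False
    then have "?t \<le> enn2real u" using le by (intro enn2real_mono) (auto simp: top.not_eq_extremum)
    then show ?thesis using * False by (simp add: reward_def)
  qed
qed

text \<open>To the right of a finite limit \<open>v\<close>, the decreasing discount function is at most its value at \<open>v\<close>, so its jumps
do no harm from that side. At \<open>\<infinity>\<close> the reward is a limit superior over all times and dominates the one along
the sequence.\<close>

lemma reward_upper_semicontinuous:
  assumes t: "t < \<infinity>" "\<And>k. t \<le> u k" and u: "u \<longlonglongrightarrow> v" "v < \<infinity> \<Longrightarrow> \<forall>\<^sub>F k in sequentially. v \<le> u k"
    and g: "\<And>x. 0 \<le> g x" and path: "continuous_on {0..} (\<lambda>s. g (X s \<omega>))"
  shows "limsup (\<lambda>k. reward D g X t (u k) \<omega>) \<le> reward D g X t v \<omega>"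
proof (cases "v = \<infinity>")
  case False
  then have v: "v < \<infinity>" by (simp add: top.not_eq_extremum)
  have tv: "t \<le> v" using t u(1) by (intro LIMSEQ_le_const) auto
  have "(\<lambda>k. enn2real (u k)) \<longlonglongrightarrow> enn2real v"
    using u(1) v by (intro tendsto_enn2real) auto
  then have "(\<lambda>k. g (X (enn2real (u k)) \<omega>)) \<longlonglongrightarrow> g (X (enn2real v) \<omega>)"
    by (intro continuous_on_tendsto_compose[OF path]) auto
  then have lim: "(\<lambda>k. ennreal (D (enn2real v - enn2real t) * g (X (enn2real (u k)) \<omega>))) \<longlonglongrightarrow> reward D g X t v \<omega>"
    using False by (auto simp: reward_def intro!: tendsto_intros tendsto_ennrealI)
  have "\<forall>\<^sub>F k in sequentially. reward D g X t (u k) \<omega> \<le> ennreal (D (enn2real v - enn2real t) * g (X (enn2real (u k)) \<omega>))"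
    using u(2)[OF v] order_tendstoD(2)[OF u(1) v]
  proof eventually_elim
    case (elim k)
    then show ?case using tv t(1) g
      by (auto simp: reward_def top.not_eq_extremum intro!: ennreal_leI mult_right_mono D_antimono enn2real_mono)
  qed
  then have "limsup (\<lambda>k. reward D g X t (u k) \<omega>) \<le>
      limsup (\<lambda>k. ennreal (D (enn2real v - enn2real t) * g (X (enn2real (u k)) \<omega>)))"
    by (rule Limsup_mono)
  also have "\<dots> = reward D g X t v \<omega>" by (rule lim_imp_Limsup[OF _ lim]) simp
  finally show ?thesis .
next
  case True
  let ?f = "\<lambda>s. ennreal (D (s - enn2real t) * g (X s \<omega>))"
  have "limsup (\<lambda>k. reward D g X t (u k) \<omega>) \<le> Limsup at_top ?f"
  proof (rule Limsup_greatest)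
    fix P :: "real \<Rightarrow> bool" assume P: "eventually P at_top"
    then obtain N where N: "\<And>s. s \<ge> N \<Longrightarrow> P s" by (auto simp: eventually_at_top_linorder)
    have "ennreal N < v" using True by simp
    from order_tendstoD(1)[OF u(1) this]
    show "limsup (\<lambda>k. reward D g X t (u k) \<omega>) \<le> (SUP s\<in>Collect P. ?f s)"
    proof (intro Limsup_bounded, eventually_elim)
      case (elim k)
      show ?case
      proof (cases "u k = \<infinity>")
        case True
        then show ?thesis using P by (auto simp: reward_def Limsup_def intro!: INF_lower)
      next
        case False
        then have "N \<le> enn2real (u k)" using elim
          by (cases "u k") (auto dest!: less_imp_le intro: ccontr[of "N \<le> _"] simp: ennreal_le_iff2)
        then show ?thesis using False N by (auto simp: reward_def intro!: SUP_upper)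
      qed
    qed
  qed
  then show ?thesis using True by (simp add: reward_def)
qed

lemma measurable_reward:
  assumes X: "\<And>t. 0 \<le> t \<Longrightarrow> (\<lambda>\<omega>. g (X t \<omega>)) \<in> borel_measurable M"
    and cont: "\<And>\<omega>. \<omega> \<in> space M \<Longrightarrow> continuous_on {0..} (\<lambda>t. g (X t \<omega>))"
    and g: "\<And>x. 0 \<le> g x"
    and [measurable]: "t \<in> borel_measurable M" "u \<in> borel_measurable M"
    and le: "\<And>\<omega>. \<omega> \<in> space M \<Longrightarrow> t \<omega> \<le> u \<omega>"
  shows "(\<lambda>\<omega>. reward D g X (t \<omega>) (u \<omega>) \<omega>) \<in> borel_measurable M"
proof -
  let ?D = "\<lambda>x. D (max 0 x)"
  note borel_measurable_D[measurable]
  have [measurable]: "(\<lambda>\<omega>. ?D (f \<omega>)) \<in> borel_measurable M" if "f \<in> borel_measurable M" for f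
    using measurable_compose[OF that borel_measurable_D] .
  have [measurable]: "(\<lambda>\<omega>. g (X (enn2real (u \<omega>)) \<omega>)) \<in> borel_measurable M"
    by (rule measurable_process_at_random_time) (auto intro!: X cont)
  let ?L = "\<lambda>\<omega>. INF n::nat. SUP q\<in>{q\<in>\<rat>. real n < q}. ennreal (?D (q - enn2real (t \<omega>)) * g (X q \<omega>))"
  have "(\<lambda>\<omega>. if u \<omega> = \<infinity> then ?L \<omega>
      else ennreal (?D (enn2real (u \<omega>) - enn2real (t \<omega>)) * g (X (enn2real (u \<omega>)) \<omega>))) \<in> borel_measurable M"
    using X
    by (intro measurable_If borel_measurable_INF borel_measurable_SUP countable_subset[OF _ countable_rat]
        measurable_compose[OF _ measurable_ennreal] borel_measurable_times) auto
  also have "?this \<longleftrightarrow> ?thesis"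
  proof (rule measurable_cong)
    fix \<omega> assume \<omega>: "\<omega> \<in> space M"
    have "Limsup at_top (\<lambda>s. ennreal (D (s - enn2real (t \<omega>)) * g (X s \<omega>))) =
        Limsup at_top (\<lambda>s. ennreal (?D (s - enn2real (t \<omega>)) * g (X s \<omega>)))"
      by (rule Limsup_eq) (auto intro!: eventually_mono[OF eventually_ge_at_top[of "enn2real (t \<omega>)"]] simp: max_def)
    also have "\<dots> = ?L \<omega>"
      by (rule Limsup_at_top_rationals[where r=0]) (auto intro!: D_antimono less_imp_le[OF D_pos] cont \<omega> g)
    finally have L: "Limsup at_top (\<lambda>s. ennreal (D (s - enn2real (t \<omega>)) * g (X s \<omega>))) = ?L \<omega>" .
    have "enn2real (t \<omega>) \<le> enn2real (u \<omega>)" if "u \<omega> \<noteq> \<infinity>"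
      using le[OF \<omega>] that by (intro enn2real_mono) (auto simp: top.not_eq_extremum)
    then show "(if u \<omega> = \<infinity> then ?L \<omega>
      else ennreal (?D (enn2real (u \<omega>) - enn2real (t \<omega>)) * g (X (enn2real (u \<omega>)) \<omega>))) = reward D g X (t \<omega>) (u \<omega>) \<omega>"
      unfolding reward_def L by (auto simp: max_def)
  qed
  finally show ?thesis .
qed

end

section \<open>Stopping times and expected rewards\<close>

lemma inverse_ennreal_antimono: "x \<le> y \<Longrightarrow> inverse y \<le> inverse (x::ennreal)"
  including ennreal.lifting by transfer (rule ereal_inverse_antimono)

lemma inverse_1_plus_le_1: "inverse (1 + x) \<le> (1::ennreal)"
  using inverse_ennreal_antimono[of 1 "1 + x"] by simp

lemma is_ess_sup_unique:
  assumes "is_ess_sup M S \<phi>" "is_ess_sup M S \<psi>"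
  shows "AE \<omega> in M. \<phi> \<omega> = \<psi> \<omega>"
proof -
  have "AE \<omega> in M. \<phi> \<omega> \<le> \<psi> \<omega>" "AE \<omega> in M. \<psi> \<omega> \<le> \<phi> \<omega>"
    using assms by (simp_all add: is_ess_sup_def)
  then show ?thesis by eventually_elim simp
qed

lemma is_ess_inf_unique:
  assumes "is_ess_inf M S \<phi>" "is_ess_inf M S \<psi>"
  shows "AE \<omega> in M. \<phi> \<omega> = \<psi> \<omega>"
proof -
  have "AE \<omega> in M. \<phi> \<omega> \<le> \<psi> \<omega>" "AE \<omega> in M. \<psi> \<omega> \<le> \<phi> \<omega>"
    using assms by (simp_all add: is_ess_inf_def)
  then show ?thesis by eventually_elim simp
qed

text \<open>The comparison of the three times is carried out for the real-valued process \<open>g(X)\<close> with continuous paths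
on a filtration that satisfies the usual conditions.\<close>

locale stopping_problem = prob_space M + filtration "space M" G + impatient_discount D
  for M :: "'w measure" and G :: "ennreal \<Rightarrow> 'w measure" and D :: "real \<Rightarrow> real" +
  fixes g :: "'x \<Rightarrow> real" and X :: "real \<Rightarrow> 'w \<Rightarrow> 'x" and J :: "'w criterion"
  assumes sets_G_le: "\<And>t. sets (G t) \<subseteq> sets M"
    and usual: "usual_conditions M G"
    and path_measurable: "\<And>t. 0 \<le> t \<Longrightarrow> (\<lambda>\<omega>. g (X t \<omega>)) \<in> borel_measurable M"
    and path_continuous: "\<And>\<omega>. \<omega> \<in> space M \<Longrightarrow> continuous_on {0..} (\<lambda>t. g (X t \<omega>))"
    and g_nonneg: "\<And>x. 0 \<le> g x"
    and class_D: "class_D M G (reward D g X 0)"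
    and coherent: "coherent_versions M G D g X J"
begin

abbreviation F :: "('w \<Rightarrow> ennreal) \<Rightarrow> 'w \<Rightarrow> ennreal" where
  "F \<equiv> F_map M G J"

lemma all_stopping_times_eq: "all_stopping_times M G = {\<tau>. stopping_time G \<tau>}"
  by (auto simp: stopping_times_def)

lemma stopping_time_measurable: "stopping_time G \<tau> \<Longrightarrow> \<tau> \<in> borel_measurable M"
  by (rule measurable_stopping_time[OF _ sets_G_le space_F])

lemma sets_pre_sigma_le: "stopping_time G \<tau> \<Longrightarrow> A \<in> sets (pre_sigma \<tau>) \<Longrightarrow> A \<in> sets M"
  using sets_pre_sigmaD[of \<tau> A top] sets_G_le[of top] by auto

lemma subalgebra_pre_sigma: "stopping_time G \<tau> \<Longrightarrow> subalgebra M (pre_sigma \<tau>)"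
  by (auto simp: subalgebra_def space_pre_sigma sets_pre_sigma_le)

lemma sigma_finite_pre_sigma: "stopping_time G \<tau> \<Longrightarrow> sigma_finite_subalgebra M (pre_sigma \<tau>)"
  by (intro finite_measure_subalgebra_is_sigma_finite finite_measure_subalgebra.intro
      finite_measure_subalgebra_axioms.intro subalgebra_pre_sigma) unfold_locales

lemma stopping_time_SUP:
  assumes "\<And>k::nat. stopping_time G (\<tau> k)"
  shows "stopping_time G (\<lambda>\<omega>. SUP k. \<tau> k \<omega>)"
  using assms by (auto simp: stopping_time_def SUP_le_iff intro!: pred_intros_countable)

lemma stopping_time_INF:
  assumes \<tau>: "\<And>k::nat. stopping_time G (\<tau> k)"
  shows "stopping_time G (\<lambda>\<omega>. INF k. \<tau> k \<omega>)"
proof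
  fix t :: ennreal
  let ?I = "\<lambda>\<omega>. INF k. \<tau> k \<omega>"
  show "Measurable.pred (G t) (\<lambda>\<omega>. ?I \<omega> \<le> t)"
  proof (cases "t = \<infinity>")
    case True
    then show ?thesis by simp
  next
    case False
    then have t: "t < \<infinity>" by (simp add: top.not_eq_extremum)
    have "{\<omega>\<in>space M. ?I \<omega> \<le> t} \<in> sets (G u)" if tu: "t < u" for u
    proof -
      obtain s where s: "\<And>n::nat. t < s n" "s \<longlonglongrightarrow> t"
        using approx_from_above_dense_linorder[OF tu] by blast
      \<comment> \<open>By right-continuity it suffices to decide the event at any later time \<open>u\<close>, which allows strict inequalities.\<close>
      have "?I \<omega> \<le> t \<longleftrightarrow> (\<forall>n. \<exists>k. \<tau> k \<omega> < min (s n) u)" for \<omega>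
      proof
        assume I: "?I \<omega> \<le> t"
        show "\<forall>n. \<exists>k. \<tau> k \<omega> < min (s n) u"
        proof
          fix n
          have "?I \<omega> < min (s n) u" using I s(1)[of n] tu by (simp add: order_le_less_trans)
          then show "\<exists>k. \<tau> k \<omega> < min (s n) u" by (simp only: INF_less_iff) auto
        qed
      next
        assume *: "\<forall>n. \<exists>k. \<tau> k \<omega> < min (s n) u"
        have "?I \<omega> \<le> s n" for n
          using * by (meson INF_lower2 UNIV_I less_imp_le min.strict_boundedE)
        then show "?I \<omega> \<le> t" by (intro LIMSEQ_le_const[OF s(2)]) auto
      qed
      then have "{\<omega>\<in>space M. ?I \<omega> \<le> t} = (\<Inter>n. \<Union>k. {\<omega>\<in>space M. \<tau> k \<omega> < min (s n) u})"
        by auto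
      also have "\<dots> \<in> sets (G u)"
      proof (intro sets.countable_INT sets.countable_UN image_subsetI)
        fix n k
        have "{\<omega>\<in>space M. \<tau> k \<omega> < min (s n) u} \<in> sets (G (min (s n) u))"
          using stopping_time_less_const[OF \<tau>[of k], of "min (s n) u"] by (simp only: Measurable.pred_def space_F)
        then show "{\<omega>\<in>space M. \<tau> k \<omega> < min (s n) u} \<in> sets (G u)"
          using sets_F_mono[of "min (s n) u" u] by auto
      qed auto
      finally show ?thesis .
    qed
    then show ?thesis
      using usual t by (auto simp: usual_conditions_def Measurable.pred_def space_F)
  qed
qed

lemma stopping_time_AE_eq:
  assumes \<tau>: "stopping_time G \<tau>" and \<phi>: "\<phi> \<in> borel_measurable M" and eq: "AE \<omega> in M. \<phi> \<omega> = \<tau> \<omega>"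
  shows "stopping_time G \<phi>"
proof
  fix t
  have [measurable]: "\<tau> \<in> borel_measurable M" "\<phi> \<in> borel_measurable M"
    using \<tau> \<phi> by (auto intro: stopping_time_measurable)
  have null: "null_sets M \<subseteq> sets (G t)"
    using usual sets_F_mono[of 0 t] unfolding usual_conditions_def by (meson order_trans zero_le)
  have "{\<omega>\<in>space M. \<phi> \<omega> \<le> t \<and> t < \<tau> \<omega>} \<in> null_sets M" "{\<omega>\<in>space M. \<tau> \<omega> \<le> t \<and> t < \<phi> \<omega>} \<in> null_sets M"
    using eq by (auto simp: null_sets_def intro!: emeasure_eq_0_AE elim!: eventually_mono)
  then have "{\<omega>\<in>space M. \<phi> \<omega> \<le> t \<and> t < \<tau> \<omega>} \<in> sets (G t)" "{\<omega>\<in>space M. \<tau> \<omega> \<le> t \<and> t < \<phi> \<omega>} \<in> sets (G t)"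
    using null by auto
  moreover have "{\<omega>\<in>space M. \<tau> \<omega> \<le> t} \<in> sets (G t)"
    using stopping_timeD[OF \<tau>] by (auto simp: Measurable.pred_def space_F)
  ultimately have "({\<omega>\<in>space M. \<tau> \<omega> \<le> t} - {\<omega>\<in>space M. \<tau> \<omega> \<le> t \<and> t < \<phi> \<omega>}) \<union>
      {\<omega>\<in>space M. \<phi> \<omega> \<le> t \<and> t < \<tau> \<omega>} \<in> sets (G t)"
    by auto
  also have "({\<omega>\<in>space M. \<tau> \<omega> \<le> t} - {\<omega>\<in>space M. \<tau> \<omega> \<le> t \<and> t < \<phi> \<omega>}) \<union>
      {\<omega>\<in>space M. \<phi> \<omega> \<le> t \<and> t < \<tau> \<omega>} = {\<omega>\<in>space M. \<phi> \<omega> \<le> t}"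
    by (auto simp: not_le)
  finally show "Measurable.pred (G t) (\<lambda>\<omega>. \<phi> \<omega> \<le> t)"
    by (simp add: Measurable.pred_def space_F)
qed

text \<open>The gluing by which the self at \<open>\<tau>\<close> revises its decision on an event that it can observe.\<close>

lemma stopping_time_switch:
  assumes \<tau>: "stopping_time G \<tau>" and \<tau>': "stopping_time G \<tau>'" and E: "E \<in> sets (pre_sigma \<tau>)"
    and le: "\<And>\<omega>. \<omega> \<in> E \<Longrightarrow> \<tau> \<omega> \<le> \<tau>' \<omega>"
  shows "stopping_time G (\<lambda>\<omega>. if \<omega> \<in> E then \<tau>' \<omega> else \<tau> \<omega>)"
proof
  fix t
  have "{\<omega>\<in>E. \<tau> \<omega> \<le> t} \<in> sets (G t)" using sets_pre_sigmaD[OF \<tau> E] .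
  moreover have "{\<omega>\<in>space M. \<tau> \<omega> \<le> t} \<in> sets (G t)" "{\<omega>\<in>space M. \<tau>' \<omega> \<le> t} \<in> sets (G t)"
    using stopping_timeD[OF \<tau>] stopping_timeD[OF \<tau>'] by (auto simp: Measurable.pred_def space_F)
  ultimately have "({\<omega>\<in>E. \<tau> \<omega> \<le> t} \<inter> {\<omega>\<in>space M. \<tau>' \<omega> \<le> t}) \<union>
      ({\<omega>\<in>space M. \<tau> \<omega> \<le> t} - {\<omega>\<in>E. \<tau> \<omega> \<le> t}) \<in> sets (G t)"
    by auto
  also have "({\<omega>\<in>E. \<tau> \<omega> \<le> t} \<inter> {\<omega>\<in>space M. \<tau>' \<omega> \<le> t}) \<union>
      ({\<omega>\<in>space M. \<tau> \<omega> \<le> t} - {\<omega>\<in>E. \<tau> \<omega> \<le> t}) =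
      {\<omega>\<in>space M. (if \<omega> \<in> E then \<tau>' \<omega> else \<tau> \<omega>) \<le> t}"
    using le sets.sets_into_space[OF E] by (force simp: space_pre_sigma dest: order_trans)
  finally show "Measurable.pred (G t) (\<lambda>\<omega>. (if \<omega> \<in> E then \<tau>' \<omega> else \<tau> \<omega>) \<le> t)"
    by (simp add: Measurable.pred_def space_F)
qed

text \<open>A bounded quantity that detects whether a stopping time has been moved on an event of positive probability; the
ordering principle is applied to it.\<close>

definition earliness :: "('w \<Rightarrow> ennreal) \<Rightarrow> real" where
  "earliness \<tau> = enn2real (\<integral>\<^sup>+\<omega>. inverse (1 + \<tau> \<omega>) \<partial>M)"

lemma earliness_integral_le_1: "(\<integral>\<^sup>+\<omega>. inverse (1 + \<tau> \<omega>) \<partial>M) \<le> 1"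
proof -
  have "(\<integral>\<^sup>+\<omega>. inverse (1 + \<tau> \<omega>) \<partial>M) \<le> (\<integral>\<^sup>+\<omega>. 1 \<partial>M)"
    by (intro nn_integral_mono inverse_1_plus_le_1)
  then show ?thesis by (simp add: emeasure_space_1)
qed

lemma earliness_bounds: "0 \<le> earliness \<tau>" "earliness \<tau> \<le> 1"
  using earliness_integral_le_1[of \<tau>] by (auto simp: earliness_def enn2real_leI)

lemma earliness_antimono:
  assumes "\<And>\<omega>. \<omega> \<in> space M \<Longrightarrow> \<tau> \<omega> \<le> \<tau>' \<omega>"
  shows "earliness \<tau>' \<le> earliness \<tau>"
  unfolding earliness_def using assms earliness_integral_le_1[of \<tau>]
  by (intro enn2real_mono nn_integral_mono inverse_ennreal_antimono add_left_mono) (auto intro: le_less_trans)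

lemma AE_eq_if_earliness_eq:
  assumes [measurable]: "\<tau> \<in> borel_measurable M" "\<tau>' \<in> borel_measurable M"
    and le: "\<And>\<omega>. \<omega> \<in> space M \<Longrightarrow> \<tau> \<omega> \<le> \<tau>' \<omega>" and eq: "earliness \<tau>' = earliness \<tau>"
  shows "AE \<omega> in M. \<tau>' \<omega> = \<tau> \<omega>"
proof -
  let ?i = "\<lambda>\<tau> \<omega>. inverse (1 + \<tau> \<omega>)"
  have fin: "(\<integral>\<^sup>+\<omega>. ?i \<tau> \<omega> \<partial>M) < \<infinity>" for \<tau>
    using earliness_integral_le_1[of \<tau>] by (auto intro: le_less_trans)
  have "(\<integral>\<^sup>+\<omega>. ?i \<tau> \<omega> - ?i \<tau>' \<omega> \<partial>M) = (\<integral>\<^sup>+\<omega>. ?i \<tau> \<omega> \<partial>M) - (\<integral>\<^sup>+\<omega>. ?i \<tau>' \<omega> \<partial>M)"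
    using fin[of \<tau>'] le by (intro nn_integral_diff) (auto intro!: AE_I2 inverse_ennreal_antimono add_left_mono)
  also have "\<dots> = 0"
    using eq fin[of \<tau>] fin[of \<tau>'] unfolding earliness_def
    by (metis ennreal_diff_self less_irrefl ennreal_enn2real infinity_ennreal_def)
  finally have "AE \<omega> in M. ?i \<tau> \<omega> - ?i \<tau>' \<omega> = 0"
    by (subst (asm) nn_integral_0_iff_AE) auto
  with AE_space show ?thesis
  proof eventually_elim
    case (elim \<omega>)
    have "?i \<tau> \<omega> \<le> ?i \<tau>' \<omega>"
      using elim(2) by (simp add: diff_eq_0_iff_ennreal inverse_1_plus_le_1 le_less_trans[OF inverse_1_plus_le_1])
    then have "\<tau>' \<omega> \<le> \<tau> \<omega>"
      by (cases "\<tau> \<omega>"; cases "\<tau>' \<omega>")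
        (auto simp: ennreal_1[symmetric] ennreal_plus[symmetric] inverse_ennreal top_unique simp del: ennreal_1 ennreal_plus)
    then show ?case using le[OF elim(1)] by simp
  qed
qed

lemma reward_measurable:
  assumes "t \<in> borel_measurable M" "u \<in> borel_measurable M" "\<And>\<omega>. \<omega> \<in> space M \<Longrightarrow> t \<omega> \<le> u \<omega>"
  shows "(\<lambda>\<omega>. reward D g X (t \<omega>) (u \<omega>) \<omega>) \<in> borel_measurable M"
  by (rule measurable_reward) (use assms path_measurable path_continuous g_nonneg in auto)

lemma expected_reward_finite:
  assumes \<tau>: "stopping_time G \<tau>"
  shows "(\<integral>\<^sup>+\<omega>. reward D g X 0 (\<tau> \<omega>) \<omega> \<partial>M) < \<infinity>"
proof -
  let ?Y = "\<lambda>\<omega>. reward D g X 0 (\<tau> \<omega>) \<omega>"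
  have [measurable]: "?Y \<in> borel_measurable M"
    using \<tau> by (intro reward_measurable) (auto intro: stopping_time_measurable)
  obtain K :: real where K: "(\<integral>\<^sup>+\<omega>. ?Y \<omega> * indicator {\<omega>. ?Y \<omega> > ennreal K} \<omega> \<partial>M) \<le> ennreal 1"
    using class_D[unfolded class_D_def all_stopping_times_eq, rule_format, of 1] \<tau> by auto
  have "(\<integral>\<^sup>+\<omega>. ?Y \<omega> \<partial>M) \<le> (\<integral>\<^sup>+\<omega>. ?Y \<omega> * indicator {\<omega>. ?Y \<omega> > ennreal K} \<omega> + ennreal K \<partial>M)"
    by (intro nn_integral_mono) (simp add: not_less split: split_indicator)
  also have "\<dots> = (\<integral>\<^sup>+\<omega>. ?Y \<omega> * indicator {\<omega>. ?Y \<omega> > ennreal K} \<omega> \<partial>M) + ennreal K"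
    by (subst nn_integral_add) (auto simp: emeasure_space_1)
  also have "\<dots> < \<infinity>" using le_less_trans[OF K] by (simp add: less_top)
  finally show ?thesis .
qed

text \<open>Class \<open>\<^bold>D\<close> replaces the integrable majorant of the reverse Fatou lemma: up to an arbitrarily small
integral, the functions may be truncated at a constant, which is integrable.\<close>

lemma class_D_reverse_Fatou:
  assumes u: "\<And>k. stopping_time G (u k)"
    and [measurable]: "\<And>k. V k \<in> borel_measurable M"
    and C: "0 < C"
    and le: "\<And>k. AE \<omega> in M. V k \<omega> \<le> ennreal C * reward D g X 0 (u k \<omega>) \<omega>"
    and lim: "AE \<omega> in M. limsup (\<lambda>k. V k \<omega>) \<le> W \<omega>"
  shows "limsup (\<lambda>k. \<integral>\<^sup>+\<omega>. V k \<omega> \<partial>M) \<le> (\<integral>\<^sup>+\<omega>. W \<omega> \<partial>M)"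
proof (rule ennreal_le_epsilon)
  fix e :: real assume e: "0 < e"
  let ?Y = "\<lambda>k \<omega>. reward D g X 0 (u k \<omega>) \<omega>"
  have [measurable]: "?Y k \<in> borel_measurable M" for k
    using u by (intro reward_measurable) (auto intro: stopping_time_measurable)
  obtain K' :: real where K': "\<And>\<tau>. stopping_time G \<tau> \<Longrightarrow>
      (\<integral>\<^sup>+\<omega>. reward D g X 0 (\<tau> \<omega>) \<omega> * indicator {\<omega>. reward D g X 0 (\<tau> \<omega>) \<omega> > ennreal K'} \<omega> \<partial>M) \<le> ennreal (e / C)"
    using class_D[unfolded class_D_def all_stopping_times_eq, rule_format, of "e / C"] C e by auto
  define L where "L = ennreal C * ennreal K'"
  have "L < \<infinity>" by (simp add: L_def ennreal_mult_less_top)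
  \<comment> \<open>Truncation at \<open>L\<close>: where \<open>V k\<close> exceeds \<open>L\<close>, the dominating reward exceeds \<open>K'\<close>.\<close>
  have split: "V k \<omega> \<le> min (V k \<omega>) L + ennreal C * (?Y k \<omega> * indicator {\<omega>. ?Y k \<omega> > ennreal K'} \<omega>)"
    if "V k \<omega> \<le> ennreal C * ?Y k \<omega>" for k \<omega>
  proof (cases "?Y k \<omega> > ennreal K'")
    case True
    then show ?thesis using that by (simp add: add_increasing)
  next
    case False
    then have "ennreal C * ?Y k \<omega> \<le> L" unfolding L_def by (intro mult_left_mono) auto
    then show ?thesis using that by (auto simp: min_def)
  qed
  have "(\<integral>\<^sup>+\<omega>. V k \<omega> \<partial>M) \<le> (\<integral>\<^sup>+\<omega>. min (V k \<omega>) L \<partial>M) + ennreal e" for k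
  proof -
    have "(\<integral>\<^sup>+\<omega>. V k \<omega> \<partial>M) \<le> (\<integral>\<^sup>+\<omega>. min (V k \<omega>) L + ennreal C * (?Y k \<omega> * indicator {\<omega>. ?Y k \<omega> > ennreal K'} \<omega>) \<partial>M)"
      by (rule nn_integral_mono_AE, use le[of k] in eventually_elim) (rule split)
    also have "\<dots> = (\<integral>\<^sup>+\<omega>. min (V k \<omega>) L \<partial>M) + ennreal C * (\<integral>\<^sup>+\<omega>. ?Y k \<omega> * indicator {\<omega>. ?Y k \<omega> > ennreal K'} \<omega> \<partial>M)"
      by (subst nn_integral_add) (auto simp: nn_integral_cmult)
    also have "\<dots> \<le> (\<integral>\<^sup>+\<omega>. min (V k \<omega>) L \<partial>M) + ennreal C * ennreal (e / C)"
      by (intro add_left_mono mult_left_mono K' u) auto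
    also have "ennreal C * ennreal (e / C) = ennreal e" using C e by (simp add: ennreal_mult[symmetric])
    finally show ?thesis .
  qed
  then have "limsup (\<lambda>k. \<integral>\<^sup>+\<omega>. V k \<omega> \<partial>M) \<le> limsup (\<lambda>k. (\<integral>\<^sup>+\<omega>. min (V k \<omega>) L \<partial>M) + ennreal e)"
    by (intro Limsup_mono always_eventually allI)
  also have "\<dots> = limsup (\<lambda>k. \<integral>\<^sup>+\<omega>. min (V k \<omega>) L \<partial>M) + ennreal e"
    by (rule Limsup_compose_continuous_mono[where f="\<lambda>x. x + ennreal e"])
      (auto intro!: continuous_intros monoI add_right_mono)
  also have "limsup (\<lambda>k. \<integral>\<^sup>+\<omega>. min (V k \<omega>) L \<partial>M) \<le> (\<integral>\<^sup>+\<omega>. limsup (\<lambda>k. min (V k \<omega>) L) \<partial>M)"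
    using \<open>L < \<infinity>\<close> by (intro nn_integral_limsup[where w="\<lambda>_. L"]) (auto simp: emeasure_space_1)
  also have "\<dots> \<le> (\<integral>\<^sup>+\<omega>. W \<omega> \<partial>M)"
  proof (rule nn_integral_mono_AE, use lim in eventually_elim)
    fix \<omega> assume "limsup (\<lambda>k. V k \<omega>) \<le> W \<omega>"
    moreover have "limsup (\<lambda>k. min (V k \<omega>) L) \<le> limsup (\<lambda>k. V k \<omega>)"
      by (intro Limsup_mono) auto
    ultimately show "limsup (\<lambda>k. min (V k \<omega>) L) \<le> W \<omega>" by simp
  qed
  finally show "limsup (\<lambda>k. \<integral>\<^sup>+\<omega>. V k \<omega> \<partial>M) \<le> (\<integral>\<^sup>+\<omega>. W \<omega> \<partial>M) + ennreal e"
    by (simp add: add_right_mono)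
qed

section \<open>The map \<open>F\<close> and the preferences of the selves\<close>

lemma F_le: "F \<rho> \<omega> \<le> \<rho> \<omega>"
  by (simp add: F_map_def)

lemma F_stopping: "stopping_time G \<rho> \<Longrightarrow> stopping_time G (F \<rho>)"
  using coherent by (auto simp: coherent_versions_def)

text \<open>Fewer continuations compete with stopping before \<open>\<rho>\<close> than before \<open>\<rho>'\<close>, so a time before \<open>\<rho>\<close> that belongs to
the stop set of \<open>\<rho>'\<close> belongs to that of \<open>\<rho>\<close>.\<close>

lemma F_mono:
  assumes le: "AE \<omega> in M. \<rho> \<omega> \<le> \<rho>' \<omega>" and \<omega>: "\<rho> \<omega> \<le> \<rho>' \<omega>"
  shows "F \<rho> \<omega> \<le> F \<rho>' \<omega>"
proof -
  have "F \<rho> \<omega> \<le> t" if t: "t \<in> stop_set M G J \<rho>' \<omega>" for t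
  proof (cases "t < \<rho> \<omega>")
    case True
    have "AE \<omega>' in M. \<tau> \<omega>' \<le> max (\<rho>' \<omega>') t" if "AE \<omega>' in M. \<tau> \<omega>' \<le> max (\<rho> \<omega>') t" for \<tau>
      using le that by eventually_elim (auto simp: le_max_iff_disj)
    then have "t \<in> stop_set M G J \<rho> \<omega>" using t True unfolding stop_set_def by blast
    then show ?thesis unfolding F_map_def by (intro min.coboundedI1 Inf_lower)
  next
    case False
    then show ?thesis using F_le[of \<rho> \<omega>] by simp
  qed
  then show ?thesis using F_le[of \<rho> \<omega>] \<omega> unfolding F_map_def[of _ _ _ \<rho>']
    by (auto intro!: Inf_greatest)
qed

text \<open>The conditional expectation that the criterion takes at the random time \<open>\<sigma>\<close>. The maximum makes it
meaningful for all \<open>\<tau>\<close>; with \<open>\<tau> = 0\<close> it is the value of stopping at once.\<close>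

definition cond_reward :: "('w \<Rightarrow> ennreal) \<Rightarrow> ('w \<Rightarrow> ennreal) \<Rightarrow> 'w \<Rightarrow> ennreal" where
  "cond_reward \<sigma> \<tau> = nn_cond_exp M (pre_sigma \<sigma>) (\<lambda>\<omega>. reward D g X (\<sigma> \<omega>) (max (\<tau> \<omega>) (\<sigma> \<omega>)) \<omega>)"

lemma cond_reward_measurable [measurable]: "cond_reward \<sigma> \<tau> \<in> borel_measurable (pre_sigma \<sigma>)"
  by (simp add: cond_reward_def)

lemma cond_reward_integral:
  assumes \<sigma>: "stopping_time G \<sigma>" and \<tau>: "stopping_time G \<tau>" and f: "f \<in> borel_measurable (pre_sigma \<sigma>)"
  shows "(\<integral>\<^sup>+\<omega>. f \<omega> * cond_reward \<sigma> \<tau> \<omega> \<partial>M) =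
    (\<integral>\<^sup>+\<omega>. f \<omega> * reward D g X (\<sigma> \<omega>) (max (\<tau> \<omega>) (\<sigma> \<omega>)) \<omega> \<partial>M)"
  unfolding cond_reward_def
  using stopping_time_measurable[OF \<sigma>] stopping_time_measurable[OF \<tau>]
  by (intro sigma_finite_subalgebra.nn_cond_exp_intg[OF sigma_finite_pre_sigma[OF \<sigma>] f] reward_measurable) auto

lemma criterion_at_stopping_time:
  assumes "stopping_time G \<sigma>" "stopping_time G \<tau>"
  shows "AE \<omega> in M. \<sigma> \<omega> < \<infinity> \<longrightarrow> J (\<lambda>\<omega>'. max (\<tau> \<omega>') (\<sigma> \<omega>)) (\<sigma> \<omega>) \<omega> = cond_reward \<sigma> \<tau> \<omega>"
  using coherent assms unfolding coherent_versions_def cond_reward_def by blast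

lemma criterion_now:
  assumes "stopping_time G \<sigma>"
  shows "AE \<omega> in M. \<sigma> \<omega> < \<infinity> \<longrightarrow> J (\<lambda>_. \<sigma> \<omega>) (\<sigma> \<omega>) \<omega> = cond_reward \<sigma> (\<lambda>_. 0) \<omega>"
  using criterion_at_stopping_time[OF assms stopping_time_const[of G 0]] by simp

text \<open>Before \<open>F \<rho>\<close> there is no time in the stop set of \<open>\<rho>\<close>. So if \<open>\<tau>\<close> comes before \<open>\<eta> \<le> F \<rho>\<close> on part of \<open>A\<close>, then by
coherence of the versions a single continuation is weakly preferred to stopping at \<open>\<tau>\<close> on an event of positive probability. The
event is described by conditional expectations, which makes it observable at \<open>\<tau>\<close>.\<close>

lemma improvement_before_F:
  assumes \<rho>: "stopping_time G \<rho>" and \<tau>: "stopping_time G \<tau>" and \<eta>: "stopping_time G \<eta>"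
    and \<eta>F: "AE \<omega> in M. \<eta> \<omega> \<le> F \<rho> \<omega>" and A: "A \<in> sets (pre_sigma \<tau>)"
    and not_AE: "\<not> (AE \<omega> in M. \<omega> \<in> A \<longrightarrow> \<eta> \<omega> \<le> \<tau> \<omega>)"
  obtains \<tau>' E where "stopping_time G \<tau>'" "AE \<omega> in M. \<tau>' \<omega> \<le> \<rho> \<omega>" "E \<in> sets (pre_sigma \<tau>)" "E \<subseteq> A"
    "\<And>\<omega>. \<omega> \<in> E \<Longrightarrow> \<tau> \<omega> < \<tau>' \<omega>" "\<And>\<omega>. \<omega> \<in> E \<Longrightarrow> cond_reward \<tau> (\<lambda>_. 0) \<omega> \<le> cond_reward \<tau> \<tau>' \<omega>"
    "\<not> (AE \<omega> in M. \<omega> \<notin> E)"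
proof -
  let ?now = "\<lambda>\<omega>. J (\<lambda>_. \<tau> \<omega>) (\<tau> \<omega>) \<omega>" and ?cont = "\<lambda>\<tau>' \<omega>. J (\<lambda>\<omega>'. max (\<tau>' \<omega>') (\<tau> \<omega>)) (\<tau> \<omega>) \<omega>"
  define A' where "A' = {\<omega>\<in>A. \<tau> \<omega> < \<eta> \<omega>}"
  have A_sub: "A \<subseteq> space M" using sets.sets_into_space[OF A] by (simp add: space_pre_sigma)
  have less: "{\<omega>\<in>space M. \<tau> \<omega> < \<eta> \<omega>} \<in> sets (pre_sigma \<tau>)" if "stopping_time G \<eta>" for \<eta>
    using stopping_time_less[OF \<tau> that] by (simp only: Measurable.pred_def space_pre_sigma)
  have "A' = A \<inter> {\<omega>\<in>space M. \<tau> \<omega> < \<eta> \<omega>}" using A_sub by (auto simp: A'_def)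
  then have A': "A' \<in> sets (pre_sigma \<tau>)" using A less[OF \<eta>] by auto
  have "\<exists>\<tau>'. stopping_time G \<tau>' \<and> (AE \<omega> in M. \<tau>' \<omega> \<le> \<rho> \<omega>) \<and>
      \<not> (AE \<omega> in M. \<omega> \<in> A' \<and> \<tau> \<omega> < \<tau>' \<omega> \<longrightarrow> ?now \<omega> > ?cont \<tau>' \<omega>)"
  proof (rule ccontr)
    assume "\<not> ?thesis"
    then have "AE \<omega> in M. \<omega> \<in> A' \<and> \<tau> \<omega> < \<tau>' \<omega> \<longrightarrow> ?now \<omega> > ?cont \<tau>' \<omega>"
      if "stopping_time G \<tau>'" "AE \<omega> in M. \<tau>' \<omega> \<le> \<rho> \<omega>" for \<tau>'
      using that by meson
    then have "AE \<omega> in M. \<omega> \<in> A' \<and> \<tau> \<omega> < \<rho> \<omega> \<longrightarrow> \<tau> \<omega> \<in> stop_set M G J \<rho> \<omega>"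
      by (intro coherent[unfolded coherent_versions_def, THEN conjunct2, THEN conjunct2, THEN conjunct1,
            THEN spec, THEN spec, THEN spec, THEN mp]) (intro conjI allI impI \<rho> \<tau> A', auto)
    with \<eta>F have "AE \<omega> in M. \<omega> \<in> A \<longrightarrow> \<eta> \<omega> \<le> \<tau> \<omega>"
    proof eventually_elim
      case (elim \<omega>)
      show ?case
      proof (intro impI leI notI)
        assume "\<omega> \<in> A" "\<tau> \<omega> < \<eta> \<omega>"
        then have "\<omega> \<in> A'" "\<tau> \<omega> < F \<rho> \<omega>" using elim by (auto simp: A'_def)
        moreover from this have "\<tau> \<omega> < \<rho> \<omega>" using F_le[of \<rho> \<omega>] by simp
        ultimately have "\<tau> \<omega> \<in> stop_set M G J \<rho> \<omega>" using elim by blast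
        then have "F \<rho> \<omega> \<le> \<tau> \<omega>" unfolding F_map_def by (intro min.coboundedI1 Inf_lower)
        then show False using \<open>\<tau> \<omega> < F \<rho> \<omega>\<close> by simp
      qed
    qed
    then show False using not_AE by simp
  qed
  then obtain \<tau>' where \<tau>': "stopping_time G \<tau>'" "AE \<omega> in M. \<tau>' \<omega> \<le> \<rho> \<omega>"
      and nJ: "\<not> (AE \<omega> in M. \<omega> \<in> A' \<and> \<tau> \<omega> < \<tau>' \<omega> \<longrightarrow> ?now \<omega> > ?cont \<tau>' \<omega>)"
    by blast
  define E where "E = A' \<inter> {\<omega>\<in>space M. \<tau> \<omega> < \<tau>' \<omega>} \<inter>
    {\<omega>\<in>space (pre_sigma \<tau>). cond_reward \<tau> (\<lambda>_. 0) \<omega> \<le> cond_reward \<tau> \<tau>' \<omega>}"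
  show thesis
  proof
    show "stopping_time G \<tau>'" "AE \<omega> in M. \<tau>' \<omega> \<le> \<rho> \<omega>" by fact+
    show "E \<in> sets (pre_sigma \<tau>)"
      unfolding E_def by (intro sets.Int A' less \<tau>') measurable
    show "E \<subseteq> A" by (auto simp: E_def A'_def)
    show "\<tau> \<omega> < \<tau>' \<omega>" "cond_reward \<tau> (\<lambda>_. 0) \<omega> \<le> cond_reward \<tau> \<tau>' \<omega>" if "\<omega> \<in> E" for \<omega>
      using that by (auto simp: E_def)
    show "\<not> (AE \<omega> in M. \<omega> \<notin> E)"
    proof
      assume "AE \<omega> in M. \<omega> \<notin> E"
      with AE_space criterion_now[OF \<tau>] criterion_at_stopping_time[OF \<tau> \<tau>'(1)]
      have "AE \<omega> in M. \<omega> \<in> A' \<and> \<tau> \<omega> < \<tau>' \<omega> \<longrightarrow> ?now \<omega> > ?cont \<tau>' \<omega>"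
      proof eventually_elim
        case (elim \<omega>)
        then show ?case by (auto simp: E_def space_pre_sigma not_le top.not_eq_extremum[symmetric])
      qed
      then show False using nJ by simp
    qed
  qed
qed

text \<open>If \<open>F \<eta> < \<eta>\<close> with positive probability, then one of the countably many stopping times along which \<open>F \<eta>\<close> is
reached comes before \<open>\<eta>\<close> with positive probability, and there \<open>\<eta>\<close> itself is one of the continuations that
are beaten by stopping.\<close>

lemma strict_preference_below:
  assumes \<eta>: "stopping_time G \<eta>" and not_AE: "\<not> (AE \<omega> in M. F \<eta> \<omega> = \<eta> \<omega>)"
  obtains \<sigma> where "stopping_time G \<sigma>" "\<not> (AE \<omega> in M. \<eta> \<omega> \<le> \<sigma> \<omega>)"
    "AE \<omega> in M. \<sigma> \<omega> < \<eta> \<omega> \<longrightarrow> cond_reward \<sigma> \<eta> \<omega> < cond_reward \<sigma> (\<lambda>_. 0) \<omega>"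
proof -
  obtain \<sigma> :: "nat \<Rightarrow> 'w \<Rightarrow> ennreal" where \<sigma>: "\<And>k. stopping_time G (\<sigma> k)"
    and AE: "AE \<omega> in M. (\<forall>k. \<sigma> k \<omega> < \<eta> \<omega> \<longrightarrow> \<sigma> k \<omega> \<in> stop_set M G J \<eta> \<omega>) \<and>
       F \<eta> \<omega> = min (INF k. \<sigma> k \<omega>) (\<eta> \<omega>)"
    using coherent \<eta> unfolding coherent_versions_def by blast
  have "\<exists>k. \<not> (AE \<omega> in M. \<eta> \<omega> \<le> \<sigma> k \<omega>)"
  proof (rule ccontr)
    assume "\<nexists>k. \<not> (AE \<omega> in M. \<eta> \<omega> \<le> \<sigma> k \<omega>)"
    then have "AE \<omega> in M. \<forall>k. \<eta> \<omega> \<le> \<sigma> k \<omega>" by (simp add: AE_all_countable)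
    with AE have "AE \<omega> in M. F \<eta> \<omega> = \<eta> \<omega>"
      by eventually_elim (auto intro!: min_absorb2 INF_greatest)
    then show False using not_AE by simp
  qed
  then obtain k where k: "\<not> (AE \<omega> in M. \<eta> \<omega> \<le> \<sigma> k \<omega>)" by blast
  have "AE \<omega> in M. \<sigma> k \<omega> < \<eta> \<omega> \<longrightarrow> cond_reward (\<sigma> k) \<eta> \<omega> < cond_reward (\<sigma> k) (\<lambda>_. 0) \<omega>"
    using AE criterion_now[OF \<sigma>, of k] criterion_at_stopping_time[OF \<sigma> \<eta>, of k]
  proof eventually_elim
    case (elim \<omega>)
    let ?s = "\<sigma> k \<omega>"
    show ?case
    proof
      assume lt: "?s < \<eta> \<omega>"
      have "(\<lambda>\<omega>'. max (\<eta> \<omega>') ?s) \<in> stopping_times M G (\<lambda>_. ?s)"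
        using \<eta> by (auto simp: stopping_times_def intro!: stopping_time_max stopping_time_const)
      moreover have "?s \<in> stop_set M G J \<eta> \<omega>" using elim lt by blast
      ultimately have "J (\<lambda>_. ?s) ?s \<omega> > J (\<lambda>\<omega>'. max (\<eta> \<omega>') ?s) ?s \<omega>"
        using lt unfolding stop_set_def by (auto simp: less_max_iff_disj)
      moreover have "?s < \<infinity>" using lt by (auto simp: top.not_eq_extremum[symmetric])
      ultimately show "cond_reward (\<sigma> k) \<eta> \<omega> < cond_reward (\<sigma> k) (\<lambda>_. 0) \<omega>" using elim by simp
    qed
  qed
  then show thesis using that[OF \<sigma> k] by blast
qed

section \<open>Plans that continue until \<open>F\<close>\<close>

text \<open>A plan of the self at \<open>\<sigma>\<close> is a pair \<open>(\<tau>, W)\<close>: stop at \<open>\<tau>\<close> and count the payoff with the weight \<open>W\<close>, which stands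
for the product of the discount factors of the steps taken so far and never exceeds \<open>D(\<tau> - \<sigma>)\<close>. Once
\<open>\<tau> = \<infinity>\<close> no further step is possible and the plan is credited with the full reward.\<close>

definition plan_value :: "('w \<Rightarrow> ennreal) \<Rightarrow> ('w \<Rightarrow> ennreal) \<times> ('w \<Rightarrow> ennreal) \<Rightarrow> 'w \<Rightarrow> ennreal" where
  "plan_value \<sigma> p \<omega> =
     (if fst p \<omega> = \<infinity> then reward D g X (\<sigma> \<omega>) \<infinity> \<omega>
      else snd p \<omega> * ennreal (g (X (enn2real (fst p \<omega>)) \<omega>)))"

definition plans :: "('w \<Rightarrow> ennreal) \<Rightarrow> ('w \<Rightarrow> ennreal) \<Rightarrow> (('w \<Rightarrow> ennreal) \<times> ('w \<Rightarrow> ennreal)) set" where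
  "plans \<sigma> \<rho> = {(\<tau>, W). stopping_time G \<tau> \<and> W \<in> borel_measurable (pre_sigma \<tau>) \<and>
     (\<forall>\<omega>\<in>space M. \<sigma> \<omega> \<le> \<tau> \<omega> \<and>
        (\<tau> \<omega> < \<infinity> \<longrightarrow> W \<omega> \<le> ennreal (D (enn2real (\<tau> \<omega>) - enn2real (\<sigma> \<omega>))))) \<and>
     (AE \<omega> in M. \<tau> \<omega> \<le> max (\<rho> \<omega>) (\<sigma> \<omega>))}"

text \<open>The discounting is compared from plan to plan and not only from \<open>\<sigma>\<close>: a factor lost at every proper step
is what makes the weight survive, or vanish, at a limit of plans.\<close>

definition plan_le :: "('w \<Rightarrow> ennreal) \<Rightarrow> 'w set \<Rightarrow> ('w \<Rightarrow> ennreal) \<times> ('w \<Rightarrow> ennreal) \<Rightarrow>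
    ('w \<Rightarrow> ennreal) \<times> ('w \<Rightarrow> ennreal) \<Rightarrow> bool" where
  "plan_le \<sigma> A p q \<longleftrightarrow>
     (\<forall>\<omega>\<in>space M. fst p \<omega> \<le> fst q \<omega> \<and>
        (fst q \<omega> < \<infinity> \<longrightarrow> snd q \<omega> \<le> snd p \<omega> * ennreal (D (enn2real (fst q \<omega>) - enn2real (fst p \<omega>))))) \<and>
     (\<integral>\<^sup>+\<omega>\<in>A. plan_value \<sigma> p \<omega> \<partial>M) \<le> (\<integral>\<^sup>+\<omega>\<in>A. plan_value \<sigma> q \<omega> \<partial>M)"

lemma plansD:
  assumes "p \<in> plans \<sigma> \<rho>"
  shows "stopping_time G (fst p)" "snd p \<in> borel_measurable (pre_sigma (fst p))"
    "\<And>\<omega>. \<omega> \<in> space M \<Longrightarrow> \<sigma> \<omega> \<le> fst p \<omega>"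
    "\<And>\<omega>. \<omega> \<in> space M \<Longrightarrow> fst p \<omega> < \<infinity> \<Longrightarrow> snd p \<omega> \<le> ennreal (D (enn2real (fst p \<omega>) - enn2real (\<sigma> \<omega>)))"
    "AE \<omega> in M. fst p \<omega> \<le> max (\<rho> \<omega>) (\<sigma> \<omega>)"
  using assms by (auto simp: plans_def)

lemma plan_value_measurable:
  assumes \<sigma>: "stopping_time G \<sigma>" and p: "p \<in> plans \<sigma> \<rho>"
  shows "plan_value \<sigma> p \<in> borel_measurable M"
proof -
  have [measurable]: "fst p \<in> borel_measurable M" "\<sigma> \<in> borel_measurable M"
    using plansD(1)[OF p] \<sigma> by (auto intro: stopping_time_measurable)
  have [measurable]: "snd p \<in> borel_measurable M"
    using measurable_from_subalg[OF subalgebra_pre_sigma[OF plansD(1)[OF p]] plansD(2)[OF p]] .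
  have [measurable]: "(\<lambda>\<omega>. reward D g X (\<sigma> \<omega>) \<infinity> \<omega>) \<in> borel_measurable M"
    by (rule reward_measurable) auto
  have [measurable]: "(\<lambda>\<omega>. g (X (enn2real (fst p \<omega>)) \<omega>)) \<in> borel_measurable M"
    by (rule measurable_process_at_random_time) (auto intro!: path_measurable path_continuous)
  show ?thesis unfolding plan_value_def[abs_def] by measurable
qed

lemma plan_value_le_reward:
  assumes p: "p \<in> plans \<sigma> \<rho>" and \<omega>: "\<omega> \<in> space M"
  shows "plan_value \<sigma> p \<omega> \<le> reward D g X (\<sigma> \<omega>) (fst p \<omega>) \<omega>"
proof (cases "fst p \<omega> = \<infinity>")
  case True
  then show ?thesis by (simp add: plan_value_def)
next
  case False
  then have lt: "fst p \<omega> < \<infinity>" by (simp add: top.not_eq_extremum)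
  have "snd p \<omega> * ennreal (g (X (enn2real (fst p \<omega>)) \<omega>)) \<le>
      ennreal (D (enn2real (fst p \<omega>) - enn2real (\<sigma> \<omega>))) * ennreal (g (X (enn2real (fst p \<omega>)) \<omega>))"
    by (intro mult_right_mono plansD(4)[OF p \<omega> lt]) auto
  then show ?thesis using False by (simp add: plan_value_def reward_def ennreal_mult'' g_nonneg)
qed

text \<open>The constant does not depend on \<open>s \<le> N\<close>. So where a stopping time is bounded by \<open>N\<close>, the rewards of the self
at that time inherit the uniform integrability of those of the self at \<open>0\<close>.\<close>

lemma reward_le_class_D:
  assumes "s \<le> t" "s \<le> ennreal N" "0 \<le> N"
  shows "reward D g X s t \<omega> \<le> ennreal (1 / D N) * reward D g X 0 t \<omega>"
proof -
  have s: "s < \<infinity>" using assms(2) by (auto intro: le_less_trans)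
  have "enn2real s \<le> N" using assms by (metis enn2real_leI)
  then have "ennreal (D N) * reward D g X s t \<omega> \<le> ennreal (D (enn2real s - enn2real 0)) * reward D g X s t \<omega>"
    by (intro mult_right_mono ennreal_leI D_antimono) auto
  also have "\<dots> \<le> reward D g X 0 t \<omega>"
    using assms s g_nonneg by (intro reward_impatience) auto
  finally have "ennreal (1 / D N) * (ennreal (D N) * reward D g X s t \<omega>) \<le> ennreal (1 / D N) * reward D g X 0 t \<omega>"
    by (rule mult_left_mono) auto
  moreover have "ennreal (1 / D N) * ennreal (D N) = 1"
    using D_pos[OF assms(3)] by (subst ennreal_mult[symmetric]) auto
  ultimately show ?thesis by (simp add: mult.assoc[symmetric])
qed

lemma plan_le_refl: "p \<in> plans \<sigma> \<rho> \<Longrightarrow> plan_le \<sigma> A p p"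
  by (simp add: plan_le_def D_0)

lemma plan_le_trans:
  assumes pq: "plan_le \<sigma> A p q" and qr: "plan_le \<sigma> A q r"
  shows "plan_le \<sigma> A p r"
  unfolding plan_le_def
proof (intro conjI ballI impI)
  fix \<omega> assume \<omega>: "\<omega> \<in> space M"
  have le: "fst p \<omega> \<le> fst q \<omega>" "fst q \<omega> \<le> fst r \<omega>" using pq qr \<omega> by (auto simp: plan_le_def)
  then show "fst p \<omega> \<le> fst r \<omega>" by simp
  assume r: "fst r \<omega> < \<infinity>"
  let ?p = "enn2real (fst p \<omega>)" and ?q = "enn2real (fst q \<omega>)" and ?r = "enn2real (fst r \<omega>)"
  have q: "fst q \<omega> < \<infinity>" using le r by simp
  have "snd r \<omega> \<le> snd q \<omega> * ennreal (D (?r - ?q))"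
    using qr \<omega> r by (simp add: plan_le_def)
  also have "\<dots> \<le> snd p \<omega> * ennreal (D (?q - ?p)) * ennreal (D (?r - ?q))"
    using pq \<omega> q by (intro mult_right_mono) (auto simp: plan_le_def)
  also have "\<dots> = snd p \<omega> * (ennreal (D (?q - ?p)) * ennreal (D (?r - ?q)))"
    by (simp add: mult.assoc)
  also have "\<dots> \<le> snd p \<omega> * ennreal (D (?r - ?p))"
    by (intro mult_left_mono D_chain enn2real_mono_finite le q r) auto
  finally show "snd r \<omega> \<le> snd p \<omega> * ennreal (D (?r - ?p))" .
qed (use pq qr in \<open>auto simp: plan_le_def\<close>)

text \<open>The upper bound is the pair of the supremum of the times and the infimum of the weights. That the discount
inequalities survive is \<open>discounted_weight_limit\<close>; that the value is not lost is the reverse Fatou lemma. For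
the latter, the plan values converge where the limit time is finite, and are bounded by
the rewards of \<open>\<sigma>\<close> where it is infinite.\<close>

lemma plan_chain_bounded:
  assumes \<sigma>: "stopping_time G \<sigma>" and A: "A \<in> sets M"
    and N: "\<And>\<omega>. \<omega> \<in> A \<Longrightarrow> \<sigma> \<omega> \<le> ennreal N" "0 \<le> N"
    and p: "\<And>k::nat. p k \<in> plans \<sigma> \<rho>" and chain: "\<And>k. plan_le \<sigma> A (p k) (p (Suc k))"
  shows "\<exists>q\<in>plans \<sigma> \<rho>. \<forall>k. plan_le \<sigma> A (p k) q"
proof -
  have le: "plan_le \<sigma> A (p i) (p j)" if "i \<le> j" for i j
    using that by (induction j rule: dec_induct) (auto intro: plan_le_refl[OF p] plan_le_trans chain)
  define \<tau> where "\<tau> \<omega> = (SUP k. fst (p k) \<omega>)" for \<omega>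
  define W where "W \<omega> = (INF k. snd (p k) \<omega>)" for \<omega>
  have \<tau>_upper: "fst (p k) \<omega> \<le> \<tau> \<omega>" for k \<omega> unfolding \<tau>_def by (rule SUP_upper) simp
  have \<tau>: "stopping_time G \<tau>"
    unfolding \<tau>_def[abs_def] by (intro stopping_time_SUP plansD(1)[OF p])
  have inc: "incseq (\<lambda>k. fst (p k) \<omega>)" if "\<omega> \<in> space M" for \<omega>
    using that chain by (intro incseq_SucI) (auto simp: plan_le_def)
  have lim: "(\<lambda>k. fst (p k) \<omega>) \<longlonglongrightarrow> \<tau> \<omega>" if "\<omega> \<in> space M" for \<omega>
    unfolding \<tau>_def by (rule LIMSEQ_SUP[OF inc[OF that]])
  have W_le: "W \<omega> \<le> snd (p k) \<omega> * ennreal (D (enn2real (\<tau> \<omega>) - enn2real (fst (p k) \<omega>)))"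
    if \<omega>: "\<omega> \<in> space M" and fin: "\<tau> \<omega> < \<infinity>" for \<omega> k
    unfolding W_def
  proof (rule discounted_weight_limit)
    have fin': "fst (p k) \<omega> < \<infinity>" for k using \<tau>_upper[of k \<omega>] fin by simp
    show "incseq (\<lambda>k. enn2real (fst (p k) \<omega>))"
      using inc[OF \<omega>] fin' by (intro monoI enn2real_mono_finite) (auto simp: incseq_def)
    show "(\<lambda>k. enn2real (fst (p k) \<omega>)) \<longlonglongrightarrow> enn2real (\<tau> \<omega>)"
      using lim[OF \<omega>] fin by (intro tendsto_enn2real) auto
    show "snd (p j) \<omega> \<le> snd (p i) \<omega> * ennreal (D (enn2real (fst (p j) \<omega>) - enn2real (fst (p i) \<omega>)))"
      if "i \<le> j" for i j
      using le[OF that] \<omega> fin' by (simp add: plan_le_def)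
    have "snd (p 0) \<omega> \<le> ennreal (D (enn2real (fst (p 0) \<omega>) - enn2real (\<sigma> \<omega>)))"
      by (rule plansD(4)[OF p \<omega> fin'])
    also have "\<dots> \<le> ennreal 1"
      by (intro ennreal_leI D_le_1) (simp add: enn2real_mono_finite plansD(3)[OF p \<omega>] fin'[unfolded infinity_ennreal_def])
    finally show "snd (p 0) \<omega> \<le> 1" by simp
  qed
  have "(\<tau>, W) \<in> plans \<sigma> \<rho>"
  proof -
    have "snd (p k) \<in> borel_measurable (pre_sigma \<tau>)" for k
      using plansD(2)[OF p, of k] mono_pre_sigma[OF plansD(1)[OF p] \<tau> \<tau>_upper, of k]
      by (auto simp: measurable_def space_pre_sigma)
    then have "W \<in> borel_measurable (pre_sigma \<tau>)"
      unfolding W_def[abs_def] by measurable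
    moreover have "\<sigma> \<omega> \<le> \<tau> \<omega>" if "\<omega> \<in> space M" for \<omega>
      using plansD(3)[OF p that, of 0] \<tau>_upper[of 0 \<omega>] by simp
    moreover have "W \<omega> \<le> ennreal (D (enn2real (\<tau> \<omega>) - enn2real (\<sigma> \<omega>)))"
      if \<omega>: "\<omega> \<in> space M" and fin: "\<tau> \<omega> < \<infinity>" for \<omega>
    proof -
      have fin0: "fst (p 0) \<omega> < \<infinity>" using \<tau>_upper[of 0 \<omega>] fin by simp
      have "W \<omega> \<le> snd (p 0) \<omega> * ennreal (D (enn2real (\<tau> \<omega>) - enn2real (fst (p 0) \<omega>)))"
        by (rule W_le[OF \<omega> fin])
      also have "\<dots> \<le> ennreal (D (enn2real (fst (p 0) \<omega>) - enn2real (\<sigma> \<omega>))) *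
          ennreal (D (enn2real (\<tau> \<omega>) - enn2real (fst (p 0) \<omega>)))"
        by (intro mult_right_mono plansD(4)[OF p \<omega> fin0]) auto
      also have "\<dots> \<le> ennreal (D (enn2real (\<tau> \<omega>) - enn2real (\<sigma> \<omega>)))"
        by (intro D_chain enn2real_mono_finite plansD(3)[OF p \<omega>] \<tau>_upper fin fin0)
      finally show ?thesis .
    qed
    moreover have "AE \<omega> in M. \<forall>k. fst (p k) \<omega> \<le> max (\<rho> \<omega>) (\<sigma> \<omega>)"
      by (subst AE_all_countable) (use plansD(5)[OF p] in blast)
    then have "AE \<omega> in M. \<tau> \<omega> \<le> max (\<rho> \<omega>) (\<sigma> \<omega>)"
      unfolding \<tau>_def by eventually_elim (auto intro!: SUP_least)
    ultimately show ?thesis using \<tau> by (simp add: plans_def)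
  qed
  moreover have "plan_le \<sigma> A (p k) (\<tau>, W)" for k
  proof -
    let ?I = "\<lambda>k. \<integral>\<^sup>+\<omega>\<in>A. plan_value \<sigma> (p k) \<omega> \<partial>M"
    have "limsup ?I \<le> (\<integral>\<^sup>+\<omega>\<in>A. plan_value \<sigma> (\<tau>, W) \<omega> \<partial>M)"
    proof (rule class_D_reverse_Fatou)
      show "stopping_time G (fst (p k))" for k by (rule plansD(1)[OF p])
      show "(\<lambda>\<omega>. plan_value \<sigma> (p k) \<omega> * indicator A \<omega>) \<in> borel_measurable M" for k
        using plan_value_measurable[OF \<sigma> p] A by measurable
      show "0 < 1 / D N" using D_pos[OF N(2)] by simp
      show "AE \<omega> in M. plan_value \<sigma> (p k) \<omega> * indicator A \<omega> \<le> ennreal (1 / D N) * reward D g X 0 (fst (p k) \<omega>) \<omega>" for k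
      proof (rule AE_I2)
        fix \<omega> assume \<omega>: "\<omega> \<in> space M"
        show "plan_value \<sigma> (p k) \<omega> * indicator A \<omega> \<le> ennreal (1 / D N) * reward D g X 0 (fst (p k) \<omega>) \<omega>"
          using order_trans[OF plan_value_le_reward[OF p \<omega>] reward_le_class_D[OF plansD(3)[OF p \<omega>] N(1) N(2)]]
          by (auto split: split_indicator)
      qed
      show "AE \<omega> in M. limsup (\<lambda>k. plan_value \<sigma> (p k) \<omega> * indicator A \<omega>) \<le> plan_value \<sigma> (\<tau>, W) \<omega> * indicator A \<omega>"
      proof (rule AE_I2)
        fix \<omega> assume \<omega>: "\<omega> \<in> space M"
        have "limsup (\<lambda>k. plan_value \<sigma> (p k) \<omega>) \<le> plan_value \<sigma> (\<tau>, W) \<omega>" if "\<omega> \<in> A"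
        proof (cases "\<tau> \<omega> = \<infinity>")
          case True
          have "limsup (\<lambda>k. plan_value \<sigma> (p k) \<omega>) \<le> limsup (\<lambda>k. reward D g X (\<sigma> \<omega>) (fst (p k) \<omega>) \<omega>)"
            by (intro Limsup_mono always_eventually allI plan_value_le_reward[OF p \<omega>])
          also have "\<dots> \<le> reward D g X (\<sigma> \<omega>) (\<tau> \<omega>) \<omega>"
            using True N(1)[OF \<open>\<omega> \<in> A\<close>] lim[OF \<omega>] plansD(3)[OF p \<omega>] g_nonneg path_continuous[OF \<omega>]
            by (intro reward_upper_semicontinuous) (auto intro: le_less_trans)
          also have "\<dots> = plan_value \<sigma> (\<tau>, W) \<omega>" using True by (simp add: plan_value_def)
          finally show ?thesis .
        next
          case False
          then have fin: "\<tau> \<omega> < \<infinity>" by (simp add: top.not_eq_extremum)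
          have fin': "fst (p k) \<omega> < \<infinity>" for k using \<tau>_upper[of k \<omega>] fin by simp
          have "decseq (\<lambda>k. snd (p k) \<omega>)"
          proof (rule decseq_SucI)
            fix k
            have "snd (p (Suc k)) \<omega> \<le> snd (p k) \<omega> * ennreal (D (enn2real (fst (p (Suc k)) \<omega>) - enn2real (fst (p k) \<omega>)))"
              using chain[of k] \<omega> fin' by (simp add: plan_le_def)
            also have "\<dots> \<le> snd (p k) \<omega> * ennreal 1"
              using inc[OF \<omega>] fin' by (intro mult_left_mono ennreal_leI D_le_1)
                (auto intro!: enn2real_mono_finite simp: incseq_Suc_iff)
            finally show "snd (p (Suc k)) \<omega> \<le> snd (p k) \<omega>" by simp
          qed
          then have W: "(\<lambda>k. snd (p k) \<omega>) \<longlonglongrightarrow> W \<omega>" unfolding W_def by (rule LIMSEQ_INF)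
          have "W \<omega> \<noteq> \<infinity>" using plansD(4)[OF \<open>(\<tau>, W) \<in> plans \<sigma> \<rho>\<close> \<omega>] fin by (auto simp: top_unique)
          moreover have "(\<lambda>k. g (X (enn2real (fst (p k) \<omega>)) \<omega>)) \<longlonglongrightarrow> g (X (enn2real (\<tau> \<omega>)) \<omega>)"
            using lim[OF \<omega>] fin
            by (intro continuous_on_tendsto_compose[OF path_continuous[OF \<omega>]] tendsto_enn2real) auto
          ultimately have "(\<lambda>k. snd (p k) \<omega> * ennreal (g (X (enn2real (fst (p k) \<omega>)) \<omega>))) \<longlonglongrightarrow>
              W \<omega> * ennreal (g (X (enn2real (\<tau> \<omega>)) \<omega>))"
            by (intro tendsto_mult_ennreal W tendsto_ennrealI) auto
          then have "(\<lambda>k. plan_value \<sigma> (p k) \<omega>) \<longlonglongrightarrow> plan_value \<sigma> (\<tau>, W) \<omega>"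
            using less_imp_neq[OF fin] less_imp_neq[OF fin'] by (simp add: plan_value_def)
          then show ?thesis by (simp add: lim_imp_Limsup)
        qed
        then show "limsup (\<lambda>k. plan_value \<sigma> (p k) \<omega> * indicator A \<omega>) \<le> plan_value \<sigma> (\<tau>, W) \<omega> * indicator A \<omega>"
          by (cases "\<omega> \<in> A") (auto simp: Limsup_const)
      qed
    qed
    moreover have "?I k \<le> limsup ?I"
      by (intro le_Limsup eventually_sequentiallyI[of k]) (use le in \<open>auto simp: plan_le_def\<close>)
    ultimately show ?thesis
      using \<tau>_upper W_le unfolding plan_le_def by (auto intro: order_trans)
  qed
  ultimately show ?thesis by blast
qed

text \<open>On the event \<open>E\<close> where the self at \<open>\<tau>\<close> weakly prefers \<open>\<tau>'\<close>, the plan is switched to \<open>\<tau>'\<close> and its weight is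
multiplied by the discount from \<open>\<tau>\<close> to \<open>\<tau>'\<close>. The weight \<open>W\<close> is known at \<open>\<tau>\<close>, so it can be pulled out of the
conditional expectation and the preference of the self at \<open>\<tau>\<close> becomes an inequality between the plan values.\<close>

lemma plan_improvable:
  assumes \<sigma>: "stopping_time G \<sigma>" and \<rho>: "stopping_time G \<rho>" and \<eta>: "stopping_time G \<eta>"
    and \<eta>F: "AE \<omega> in M. \<eta> \<omega> \<le> F \<rho> \<omega>" and A: "A \<in> sets (pre_sigma \<sigma>)"
    and p: "p \<in> plans \<sigma> \<rho>" and early: "\<not> (AE \<omega> in M. \<omega> \<in> A \<longrightarrow> \<eta> \<omega> \<le> fst p \<omega>)"
  shows "\<exists>q\<in>plans \<sigma> \<rho>. plan_le \<sigma> A p q \<and> \<not> (AE \<omega> in M. fst q \<omega> = fst p \<omega>)"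
proof -
  obtain \<tau> W where pW: "p = (\<tau>, W)" by (cases p)
  note pD = plansD[OF p, unfolded pW fst_conv snd_conv]
  have \<tau>: "stopping_time G \<tau>" by (rule pD)
  have A\<tau>: "A \<in> sets (pre_sigma \<tau>)"
    using mono_pre_sigma[OF \<sigma> \<tau> pD(3)] A by auto
  obtain \<tau>' E where \<tau>': "stopping_time G \<tau>'" and \<tau>'\<rho>: "AE \<omega> in M. \<tau>' \<omega> \<le> \<rho> \<omega>"
    and E: "E \<in> sets (pre_sigma \<tau>)" "E \<subseteq> A" and less: "\<And>\<omega>. \<omega> \<in> E \<Longrightarrow> \<tau> \<omega> < \<tau>' \<omega>"
    and better: "\<And>\<omega>. \<omega> \<in> E \<Longrightarrow> cond_reward \<tau> (\<lambda>_. 0) \<omega> \<le> cond_reward \<tau> \<tau>' \<omega>"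
    and E_pos: "\<not> (AE \<omega> in M. \<omega> \<notin> E)"
    by (rule improvement_before_F[OF \<rho> \<tau> \<eta> \<eta>F A\<tau> early[unfolded pW fst_conv]]) (rule that)
  define \<tau>'' where "\<tau>'' \<omega> = (if \<omega> \<in> E then \<tau>' \<omega> else \<tau> \<omega>)" for \<omega>
  \<comment> \<open>The maximum with \<open>0\<close> only serves measurability, as \<open>D\<close> is monotone on the half-line alone.\<close>
  define W'' where "W'' \<omega> = (if \<tau>'' \<omega> = \<infinity> then 0
      else W \<omega> * ennreal (D (max 0 (enn2real (\<tau>'' \<omega>) - enn2real (\<tau> \<omega>)))))" for \<omega>
  have \<tau>'': "stopping_time G \<tau>''"
    unfolding \<tau>''_def[abs_def] using less by (intro stopping_time_switch \<tau> \<tau>' E) (auto intro: less_imp_le)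
  have \<tau>_le: "\<tau> \<omega> \<le> \<tau>'' \<omega>" for \<omega> using less[of \<omega>] by (auto simp: \<tau>''_def)
  have W''_eq: "W'' \<omega> = W \<omega> * ennreal (D (enn2real (\<tau>'' \<omega>) - enn2real (\<tau> \<omega>)))" if "\<tau>'' \<omega> < \<infinity>" for \<omega>
    using enn2real_mono_finite[OF \<tau>_le that] that by (simp add: W''_def max_def)
  have sub: "sets (pre_sigma \<tau>) \<subseteq> sets (pre_sigma \<tau>'')" by (rule mono_pre_sigma[OF \<tau> \<tau>'' \<tau>_le])
  have q: "(\<tau>'', W'') \<in> plans \<sigma> \<rho>"
  proof -
    have lift: "f \<in> borel_measurable (pre_sigma \<tau>'')" if "f \<in> borel_measurable (pre_sigma \<tau>)" for f :: "'w \<Rightarrow> ennreal"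
      using that sub by (auto simp: measurable_def space_pre_sigma)
    note [measurable] = lift[OF measurable_stopping_time_pre_sigma[OF \<tau>]] lift[OF pD(2)]
      measurable_stopping_time_pre_sigma[OF \<tau>'']
    have [measurable]: "(\<lambda>\<omega>. D (max 0 (enn2real (\<tau>'' \<omega>) - enn2real (\<tau> \<omega>)))) \<in> borel_measurable (pre_sigma \<tau>'')"
      by (rule measurable_compose[OF _ borel_measurable_D]) measurable
    have "W'' \<in> borel_measurable (pre_sigma \<tau>'')"
      unfolding W''_def[abs_def] by measurable
    moreover have "W'' \<omega> \<le> ennreal (D (enn2real (\<tau>'' \<omega>) - enn2real (\<sigma> \<omega>)))"
      if \<omega>: "\<omega> \<in> space M" and fin: "\<tau>'' \<omega> < \<infinity>" for \<omega>
    proof -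
      have fin': "\<tau> \<omega> < \<infinity>" using \<tau>_le[of \<omega>] fin by simp
      have "W'' \<omega> \<le> ennreal (D (enn2real (\<tau> \<omega>) - enn2real (\<sigma> \<omega>))) * ennreal (D (enn2real (\<tau>'' \<omega>) - enn2real (\<tau> \<omega>)))"
        unfolding W''_eq[OF fin] by (intro mult_right_mono pD(4)[OF \<omega> fin']) auto
      also have "\<dots> \<le> ennreal (D (enn2real (\<tau>'' \<omega>) - enn2real (\<sigma> \<omega>)))"
        by (intro D_chain enn2real_mono_finite pD(3)[OF \<omega>] \<tau>_le fin fin')
      finally show ?thesis .
    qed
    moreover have "AE \<omega> in M. \<tau>'' \<omega> \<le> max (\<rho> \<omega>) (\<sigma> \<omega>)"
      using pD(5) \<tau>'\<rho> by eventually_elim (auto simp: \<tau>''_def le_max_iff_disj)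
    ultimately show ?thesis using \<tau>'' pD(3) \<tau>_le by (auto simp: plans_def intro: order_trans)
  qed
  have EM[measurable]: "E \<in> sets M" and AM[measurable]: "A \<in> sets M"
    using E(1) A\<tau> sets_pre_sigma_le[OF \<tau>] by auto
  note [measurable] = plan_value_measurable[OF \<sigma> p] plan_value_measurable[OF \<sigma> q]
  have on_E: "(\<integral>\<^sup>+\<omega>\<in>E. plan_value \<sigma> p \<omega> \<partial>M) \<le> (\<integral>\<^sup>+\<omega>\<in>E. plan_value \<sigma> (\<tau>'', W'') \<omega> \<partial>M)"
  proof -
    let ?f = "\<lambda>\<omega>. W \<omega> * indicator E \<omega>"
    have f: "?f \<in> borel_measurable (pre_sigma \<tau>)" using pD(2) E(1) by measurable
    have "(\<integral>\<^sup>+\<omega>\<in>E. plan_value \<sigma> p \<omega> \<partial>M) = (\<integral>\<^sup>+\<omega>. ?f \<omega> * reward D g X (\<tau> \<omega>) (max 0 (\<tau> \<omega>)) \<omega> \<partial>M)"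
    proof (rule nn_integral_cong)
      fix \<omega>
      show "plan_value \<sigma> p \<omega> * indicator E \<omega> = ?f \<omega> * reward D g X (\<tau> \<omega>) (max 0 (\<tau> \<omega>)) \<omega>"
      proof (cases "\<omega> \<in> E")
        case True
        then have "\<tau> \<omega> < \<infinity>" using less[of \<omega>] by (auto simp: top.not_eq_extremum[symmetric])
        then show ?thesis using True reward_same[of "\<tau> \<omega>" g X \<omega>]
          by (auto simp: plan_value_def pW)
      qed simp
    qed
    also have "\<dots> = (\<integral>\<^sup>+\<omega>. ?f \<omega> * cond_reward \<tau> (\<lambda>_. 0) \<omega> \<partial>M)"
      by (rule cond_reward_integral[OF \<tau> stopping_time_const f, symmetric])
    also have "\<dots> \<le> (\<integral>\<^sup>+\<omega>. ?f \<omega> * cond_reward \<tau> \<tau>' \<omega> \<partial>M)"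
      by (intro nn_integral_mono) (auto split: split_indicator intro!: mult_left_mono better)
    also have "\<dots> = (\<integral>\<^sup>+\<omega>. ?f \<omega> * reward D g X (\<tau> \<omega>) (max (\<tau>' \<omega>) (\<tau> \<omega>)) \<omega> \<partial>M)"
      by (rule cond_reward_integral[OF \<tau> \<tau>' f])
    also have "\<dots> \<le> (\<integral>\<^sup>+\<omega>\<in>E. plan_value \<sigma> (\<tau>'', W'') \<omega> \<partial>M)"
    proof (rule nn_integral_mono)
      fix \<omega> assume \<omega>: "\<omega> \<in> space M"
      have "W \<omega> * reward D g X (\<tau> \<omega>) (max (\<tau>' \<omega>) (\<tau> \<omega>)) \<omega> \<le> plan_value \<sigma> (\<tau>'', W'') \<omega>" if "\<omega> \<in> E"
      proof -
        have mx: "max (\<tau>' \<omega>) (\<tau> \<omega>) = \<tau>'' \<omega>" using less[OF that] that by (simp add: \<tau>''_def)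
        have fin: "\<tau> \<omega> < \<infinity>" using less[OF that] by (auto simp: top.not_eq_extremum[symmetric])
        show ?thesis
        proof (cases "\<tau>'' \<omega> = \<infinity>")
          case True
          have "W \<omega> * reward D g X (\<tau> \<omega>) \<infinity> \<omega> \<le>
              ennreal (D (enn2real (\<tau> \<omega>) - enn2real (\<sigma> \<omega>))) * reward D g X (\<tau> \<omega>) \<infinity> \<omega>"
            by (intro mult_right_mono pD(4)[OF \<omega> fin]) auto
          also have "\<dots> \<le> reward D g X (\<sigma> \<omega>) \<infinity> \<omega>"
            using pD(3)[OF \<omega>] fin g_nonneg by (intro reward_impatience) auto
          finally show ?thesis using True mx by (simp add: plan_value_def)
        next
          case False
          then have "\<tau>'' \<omega> < \<infinity>" by (simp add: top.not_eq_extremum)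
          from W''_eq[OF this] show ?thesis using mx False
            by (simp add: plan_value_def reward_def ennreal_mult'' g_nonneg mult.assoc)
        qed
      qed
      then show "?f \<omega> * reward D g X (\<tau> \<omega>) (max (\<tau>' \<omega>) (\<tau> \<omega>)) \<omega> \<le> plan_value \<sigma> (\<tau>'', W'') \<omega> * indicator E \<omega>"
        by (auto split: split_indicator)
    qed
    finally show ?thesis .
  qed
  have split: "(\<integral>\<^sup>+\<omega>\<in>A. V \<omega> \<partial>M) = (\<integral>\<^sup>+\<omega>\<in>A - E. V \<omega> \<partial>M) + (\<integral>\<^sup>+\<omega>\<in>E. V \<omega> \<partial>M)"
    if [measurable]: "V \<in> borel_measurable M" for V :: "'w \<Rightarrow> ennreal"
    using E(2) by (subst nn_integral_add[symmetric]) (auto intro!: nn_integral_cong split: split_indicator)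
  have off_E: "(\<integral>\<^sup>+\<omega>\<in>A - E. plan_value \<sigma> p \<omega> \<partial>M) = (\<integral>\<^sup>+\<omega>\<in>A - E. plan_value \<sigma> (\<tau>'', W'') \<omega> \<partial>M)"
    by (intro nn_integral_cong) (auto simp: plan_value_def pW \<tau>''_def W''_def D_0 split: split_indicator)
  have "(\<integral>\<^sup>+\<omega>\<in>A. plan_value \<sigma> p \<omega> \<partial>M) \<le> (\<integral>\<^sup>+\<omega>\<in>A. plan_value \<sigma> (\<tau>'', W'') \<omega> \<partial>M)"
    using on_E by (simp add: split off_E add_left_mono)
  then have "plan_le \<sigma> A p (\<tau>'', W'')"
    using \<tau>_le W''_eq by (auto simp: plan_le_def pW)
  moreover have "\<not> (AE \<omega> in M. \<tau>'' \<omega> = \<tau> \<omega>)"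
  proof
    assume "AE \<omega> in M. \<tau>'' \<omega> = \<tau> \<omega>"
    then have "AE \<omega> in M. \<omega> \<notin> E"
      by eventually_elim (use less in \<open>force simp: \<tau>''_def\<close>)
    then show False using E_pos by simp
  qed
  ultimately show ?thesis using q by (auto simp: pW)
qed

text \<open>A plan that cannot be prolonged, which the ordering principle provides, reaches \<open>\<eta>\<close> on \<open>A\<close> by
\<open>plan_improvable\<close>. Starting with the plan of stopping at \<open>\<sigma>\<close> with weight \<open>1\<close> compares the outcome with stopping at once.\<close>

lemma continuation_until_F:
  assumes \<sigma>: "stopping_time G \<sigma>" and \<rho>: "stopping_time G \<rho>" and \<eta>: "stopping_time G \<eta>"
    and \<eta>F: "AE \<omega> in M. \<eta> \<omega> \<le> F \<rho> \<omega>" and A: "A \<in> sets (pre_sigma \<sigma>)"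
    and before: "\<And>\<omega>. \<omega> \<in> A \<Longrightarrow> \<sigma> \<omega> < \<eta> \<omega>" and N: "\<And>\<omega>. \<omega> \<in> A \<Longrightarrow> \<sigma> \<omega> \<le> ennreal N" "0 \<le> N"
  obtains \<tau> where "stopping_time G \<tau>" "\<And>\<omega>. \<omega> \<in> space M \<Longrightarrow> \<sigma> \<omega> \<le> \<tau> \<omega>"
    "AE \<omega> in M. \<omega> \<in> A \<longrightarrow> \<eta> \<omega> \<le> \<tau> \<omega> \<and> \<tau> \<omega> \<le> \<rho> \<omega>"
    "(\<integral>\<^sup>+\<omega>\<in>A. reward D g X (\<sigma> \<omega>) (\<sigma> \<omega>) \<omega> \<partial>M) \<le> (\<integral>\<^sup>+\<omega>\<in>A. reward D g X (\<sigma> \<omega>) (\<tau> \<omega>) \<omega> \<partial>M)"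
proof -
  have AM: "A \<in> sets M" using sets_pre_sigma_le[OF \<sigma> A] .
  let ?p0 = "(\<sigma>, \<lambda>_. 1) :: ('w \<Rightarrow> ennreal) \<times> ('w \<Rightarrow> ennreal)"
  have p0: "?p0 \<in> plans \<sigma> \<rho>"
    using \<sigma> by (auto simp: plans_def D_0)
  obtain p where p: "p \<in> plans \<sigma> \<rho>" "plan_le \<sigma> A ?p0 p"
    and max: "\<And>q. q \<in> plans \<sigma> \<rho> \<Longrightarrow> plan_le \<sigma> A p q \<Longrightarrow> - earliness (fst q) = - earliness (fst p)"
  proof (rule ordering_principle[where S="plans \<sigma> \<rho>" and le="plan_le \<sigma> A" and f="\<lambda>p. - earliness (fst p)" and C=0, OF p0])
    show "plan_le \<sigma> A p p" if "p \<in> plans \<sigma> \<rho>" for p using that by (rule plan_le_refl)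
    show "plan_le \<sigma> A p r" if "plan_le \<sigma> A p q" "plan_le \<sigma> A q r" for p q r using that by (rule plan_le_trans)
    show "- earliness (fst p) \<le> - earliness (fst q)" if "plan_le \<sigma> A p q" for p q
      using that by (auto simp: plan_le_def intro!: earliness_antimono)
    show "- earliness (fst p) \<le> 0" for p :: "('w \<Rightarrow> ennreal) \<times> ('w \<Rightarrow> ennreal)" by (simp add: earliness_bounds)
    show "\<exists>q\<in>plans \<sigma> \<rho>. \<forall>k. plan_le \<sigma> A (p k) q"
      if "\<And>k. p k \<in> plans \<sigma> \<rho>" "\<And>k. plan_le \<sigma> A (p k) (p (Suc k))" for p :: "nat \<Rightarrow> _"
      by (rule plan_chain_bounded[where N=N, OF \<sigma> AM]) (simp_all add: N that)
  qed blast
  have late: "AE \<omega> in M. \<omega> \<in> A \<longrightarrow> \<eta> \<omega> \<le> fst p \<omega>"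
  proof (rule ccontr)
    assume "\<not> ?thesis"
    from plan_improvable[OF \<sigma> \<rho> \<eta> \<eta>F A p(1) this] obtain q where
      q: "q \<in> plans \<sigma> \<rho>" "plan_le \<sigma> A p q" "\<not> (AE \<omega> in M. fst q \<omega> = fst p \<omega>)" by blast
    have "AE \<omega> in M. fst q \<omega> = fst p \<omega>"
      using max[OF q(1,2)] q(2) plansD(1)[OF p(1)] plansD(1)[OF q(1)]
      by (intro AE_eq_if_earliness_eq stopping_time_measurable) (auto simp: plan_le_def)
    then show False using q(3) by simp
  qed
  show thesis
  proof
    show "stopping_time G (fst p)" "\<And>\<omega>. \<omega> \<in> space M \<Longrightarrow> \<sigma> \<omega> \<le> fst p \<omega>" using plansD[OF p(1)] by auto
    show "AE \<omega> in M. \<omega> \<in> A \<longrightarrow> \<eta> \<omega> \<le> fst p \<omega> \<and> fst p \<omega> \<le> \<rho> \<omega>"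
      using late plansD(5)[OF p(1)] \<eta>F
    proof eventually_elim
      case (elim \<omega>)
      show ?case
      proof
        assume "\<omega> \<in> A"
        then have "\<sigma> \<omega> \<le> \<rho> \<omega>" using before[of \<omega>] elim(3) F_le[of \<rho> \<omega>] by auto
        then show "\<eta> \<omega> \<le> fst p \<omega> \<and> fst p \<omega> \<le> \<rho> \<omega>" using elim(1,2) \<open>\<omega> \<in> A\<close> by (auto simp: max_def split: if_splits)
      qed
    qed
    have "(\<integral>\<^sup>+\<omega>\<in>A. reward D g X (\<sigma> \<omega>) (\<sigma> \<omega>) \<omega> \<partial>M) = (\<integral>\<^sup>+\<omega>\<in>A. plan_value \<sigma> ?p0 \<omega> \<partial>M)"
    proof (intro nn_integral_cong)
      fix \<omega>
      have "\<sigma> \<omega> < \<infinity>" if "\<omega> \<in> A" using before[OF that] by (auto simp: top.not_eq_extremum[symmetric])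
      then show "reward D g X (\<sigma> \<omega>) (\<sigma> \<omega>) \<omega> * indicator A \<omega> = plan_value \<sigma> ?p0 \<omega> * indicator A \<omega>"
        by (auto simp: reward_same plan_value_def split: split_indicator)
    qed
    also have "\<dots> \<le> (\<integral>\<^sup>+\<omega>\<in>A. plan_value \<sigma> p \<omega> \<partial>M)" using p(2) by (simp add: plan_le_def)
    also have "\<dots> \<le> (\<integral>\<^sup>+\<omega>\<in>A. reward D g X (\<sigma> \<omega>) (fst p \<omega>) \<omega> \<partial>M)"
      by (intro nn_integral_mono mult_right_mono plan_value_le_reward[OF p(1)]) auto
    finally show "(\<integral>\<^sup>+\<omega>\<in>A. reward D g X (\<sigma> \<omega>) (\<sigma> \<omega>) \<omega> \<partial>M) \<le> (\<integral>\<^sup>+\<omega>\<in>A. reward D g X (\<sigma> \<omega>) (fst p \<omega>) \<omega> \<partial>M)" .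
  qed
qed

section \<open>The limit of the naive times is approachable\<close>

lemma naive_stopping: "stopping_time G (naive_time M G J n)"
  by (induction n) (auto intro: stopping_time_const F_stopping)

lemma naive_decseq: "decseq (\<lambda>n. naive_time M G J n \<omega>)"
  by (rule decseq_SucI) (simp add: F_le)

lemma naive_limit_eq: "naive_limit M G J \<omega> = (INF n. naive_time M G J n \<omega>)"
  unfolding naive_limit_def by (rule limI[OF LIMSEQ_INF[OF naive_decseq]])

lemma naive_limit_stopping: "stopping_time G (naive_limit M G J)"
  using stopping_time_INF[of "naive_time M G J", OF naive_stopping] by (simp add: naive_limit_eq[abs_def])

lemma naive_limit_le: "naive_limit M G J \<omega> \<le> naive_time M G J n \<omega>"
  unfolding naive_limit_eq by (rule INF_lower) simp

text \<open>At a stopping time \<open>\<sigma>\<close> where stopping is strictly better than \<open>\<rho>\<^sub>\<infinity>\<close>, there are for every \<open>n\<close> weakly better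
continuations between \<open>\<rho>\<^sub>\<infinity>\<close> and the \<open>n\<close>-th naive time. Their limit is \<open>\<rho>\<^sub>\<infinity>\<close>, which would therefore be weakly better
on average, against the strict preference.\<close>

lemma naive_limit_approachable: "AE \<omega> in M. F (naive_limit M G J) \<omega> = naive_limit M G J \<omega>"
proof (rule ccontr)
  let ?\<eta> = "naive_limit M G J" and ?\<rho> = "naive_time M G J"
  assume not_AE: "\<not> ?thesis"
  obtain \<sigma> where \<sigma>: "stopping_time G \<sigma>" and not_late: "\<not> (AE \<omega> in M. ?\<eta> \<omega> \<le> \<sigma> \<omega>)"
    and strict: "AE \<omega> in M. \<sigma> \<omega> < ?\<eta> \<omega> \<longrightarrow> cond_reward \<sigma> ?\<eta> \<omega> < cond_reward \<sigma> (\<lambda>_. 0) \<omega>"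
    using strict_preference_below[OF naive_limit_stopping not_AE] by blast
  \<comment> \<open>Bounding \<open>\<sigma>\<close> by \<open>N\<close> makes the rewards of the self at \<open>\<sigma>\<close> uniformly integrable.\<close>
  define A where "A N = {\<omega>\<in>space (pre_sigma \<sigma>). \<sigma> \<omega> < ?\<eta> \<omega>} \<inter> {\<omega>\<in>space (pre_sigma \<sigma>). \<sigma> \<omega> \<le> ennreal (real N)}" for N
  have "\<exists>N. \<not> (AE \<omega> in M. \<omega> \<notin> A N)"
  proof (rule ccontr)
    assume "\<nexists>N. \<not> (AE \<omega> in M. \<omega> \<notin> A N)"
    then have "AE \<omega> in M. \<forall>N. \<omega> \<notin> A N" by (simp add: AE_all_countable)
    with AE_space have "AE \<omega> in M. ?\<eta> \<omega> \<le> \<sigma> \<omega>"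
    proof eventually_elim
      case (elim \<omega>)
      show ?case
      proof (rule leI, rule notI)
        assume lt: "\<sigma> \<omega> < ?\<eta> \<omega>"
        then have "\<sigma> \<omega> < \<infinity>" by (auto simp: top.not_eq_extremum[symmetric])
        then obtain r where r: "\<sigma> \<omega> = ennreal r" by (cases "\<sigma> \<omega>") auto
        obtain N :: nat where "r \<le> real N" using real_arch_simple by blast
        then have "\<omega> \<in> A N" using lt r elim(1) by (auto simp: A_def space_pre_sigma intro!: ennreal_leI)
        then show False using elim by blast
      qed
    qed
    then show False using not_late by simp
  qed
  then obtain N where A_pos: "\<not> (AE \<omega> in M. \<omega> \<notin> A N)" by blast
  let ?A = "A N" and ?N = "real N"
  have A: "?A \<in> sets (pre_sigma \<sigma>)"
    unfolding A_def
  proof (rule sets.Int)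
    show "{\<omega>\<in>space (pre_sigma \<sigma>). \<sigma> \<omega> < ?\<eta> \<omega>} \<in> sets (pre_sigma \<sigma>)"
      using stopping_time_less[OF \<sigma> naive_limit_stopping] by (simp only: Measurable.pred_def)
    show "{\<omega>\<in>space (pre_sigma \<sigma>). \<sigma> \<omega> \<le> ennreal (real N)} \<in> sets (pre_sigma \<sigma>)"
      using measurable_stopping_time_pre_sigma[OF \<sigma>] by measurable
  qed
  have A_before: "\<And>\<omega>. \<omega> \<in> ?A \<Longrightarrow> \<sigma> \<omega> < ?\<eta> \<omega>" and A_N: "\<And>\<omega>. \<omega> \<in> ?A \<Longrightarrow> \<sigma> \<omega> \<le> ennreal ?N"
    by (auto simp: A_def)
  have AM[measurable]: "?A \<in> sets M" using sets_pre_sigma_le[OF \<sigma> A] .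
  note [measurable] = stopping_time_measurable[OF \<sigma>] stopping_time_measurable[OF naive_limit_stopping]
  let ?R = "\<lambda>\<tau> \<omega>. reward D g X (\<sigma> \<omega>) (max (\<tau> \<omega>) (\<sigma> \<omega>)) \<omega>"
  have R[measurable]: "?R \<tau> \<in> borel_measurable M" if "stopping_time G \<tau>" for \<tau>
    using stopping_time_measurable[OF that] by (intro reward_measurable) auto

  let ?good = "\<lambda>n \<tau>. stopping_time G \<tau> \<and> (\<forall>\<omega>\<in>space M. \<sigma> \<omega> \<le> \<tau> \<omega>) \<and>
      (AE \<omega> in M. \<omega> \<in> ?A \<longrightarrow> ?\<eta> \<omega> \<le> \<tau> \<omega> \<and> \<tau> \<omega> \<le> ?\<rho> n \<omega>) \<and>
      (\<integral>\<^sup>+\<omega>\<in>?A. reward D g X (\<sigma> \<omega>) (\<sigma> \<omega>) \<omega> \<partial>M) \<le> (\<integral>\<^sup>+\<omega>\<in>?A. reward D g X (\<sigma> \<omega>) (\<tau> \<omega>) \<omega> \<partial>M)"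
  have "\<exists>\<tau>. ?good n \<tau>" for n
  proof -
    have "AE \<omega> in M. ?\<eta> \<omega> \<le> F (?\<rho> n) \<omega>" using naive_limit_le[of _ "Suc n"] by simp
    then show ?thesis
      by (rule continuation_until_F[where \<eta>="?\<eta>" and \<rho>="?\<rho> n", OF \<sigma> naive_stopping naive_limit_stopping _ A A_before A_N of_nat_0_le_iff]) auto
  qed
  then have "\<exists>\<tau>. \<forall>n. ?good n (\<tau> n)" by (intro choice allI)
  then obtain \<tau> where good: "\<forall>n. ?good n (\<tau> n)" by (elim exE)
  then have \<tau>: "\<And>n. stopping_time G (\<tau> n)" and \<sigma>\<tau>: "\<And>n \<omega>. \<omega> \<in> space M \<Longrightarrow> \<sigma> \<omega> \<le> \<tau> n \<omega>"
    and between: "\<And>n. AE \<omega> in M. \<omega> \<in> ?A \<longrightarrow> ?\<eta> \<omega> \<le> \<tau> n \<omega> \<and> \<tau> n \<omega> \<le> ?\<rho> n \<omega>"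
    and gain: "\<And>n. (\<integral>\<^sup>+\<omega>\<in>?A. reward D g X (\<sigma> \<omega>) (\<sigma> \<omega>) \<omega> \<partial>M) \<le> (\<integral>\<^sup>+\<omega>\<in>?A. reward D g X (\<sigma> \<omega>) (\<tau> n \<omega>) \<omega> \<partial>M)"
    by auto

  have "limsup (\<lambda>n. \<integral>\<^sup>+\<omega>\<in>?A. reward D g X (\<sigma> \<omega>) (\<tau> n \<omega>) \<omega> \<partial>M) \<le> (\<integral>\<^sup>+\<omega>\<in>?A. ?R ?\<eta> \<omega> \<partial>M)"
  proof (rule class_D_reverse_Fatou[OF \<tau>])
    show "(\<lambda>\<omega>. reward D g X (\<sigma> \<omega>) (\<tau> n \<omega>) \<omega> * indicator ?A \<omega>) \<in> borel_measurable M" for n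
    proof -
      have "(\<lambda>\<omega>. reward D g X (\<sigma> \<omega>) (\<tau> n \<omega>) \<omega>) \<in> borel_measurable M"
        using \<sigma>\<tau> stopping_time_measurable[OF \<tau>] by (intro reward_measurable) auto
      then show ?thesis by measurable
    qed
    show "0 < 1 / D ?N" using D_pos[of ?N] by simp
    show "AE \<omega> in M. reward D g X (\<sigma> \<omega>) (\<tau> n \<omega>) \<omega> * indicator ?A \<omega> \<le> ennreal (1 / D ?N) * reward D g X 0 (\<tau> n \<omega>) \<omega>" for n
      by (rule AE_I2) (auto split: split_indicator intro!: reward_le_class_D \<sigma>\<tau> A_N)
    have "AE \<omega> in M. \<forall>n. \<omega> \<in> ?A \<longrightarrow> ?\<eta> \<omega> \<le> \<tau> n \<omega> \<and> \<tau> n \<omega> \<le> ?\<rho> n \<omega>"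
      using between by (subst AE_all_countable) blast
    with AE_space show "AE \<omega> in M. limsup (\<lambda>n. reward D g X (\<sigma> \<omega>) (\<tau> n \<omega>) \<omega> * indicator ?A \<omega>) \<le> ?R ?\<eta> \<omega> * indicator ?A \<omega>"
    proof eventually_elim
      case (elim \<omega>)
      have "limsup (\<lambda>n. reward D g X (\<sigma> \<omega>) (\<tau> n \<omega>) \<omega>) \<le> reward D g X (\<sigma> \<omega>) (?\<eta> \<omega>) \<omega>" if "\<omega> \<in> ?A"
      proof (rule reward_upper_semicontinuous)
        have bounds: "?\<eta> \<omega> \<le> \<tau> n \<omega>" "\<tau> n \<omega> \<le> ?\<rho> n \<omega>" for n using elim(2) that by auto
        show "\<sigma> \<omega> < \<infinity>" using A_N[OF that] by (rule le_less_trans) simp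
        show "\<sigma> \<omega> \<le> \<tau> n \<omega>" for n using elim(1) by (rule \<sigma>\<tau>)
        show "\<forall>\<^sub>F n in sequentially. ?\<eta> \<omega> \<le> \<tau> n \<omega>" by (intro always_eventually allI bounds)
        have "(\<lambda>n. ?\<rho> n \<omega>) \<longlonglongrightarrow> ?\<eta> \<omega>" unfolding naive_limit_eq by (rule LIMSEQ_INF[OF naive_decseq])
        then show "(\<lambda>n. \<tau> n \<omega>) \<longlonglongrightarrow> ?\<eta> \<omega>"
          by (rule tendsto_sandwich[OF always_eventually[OF allI[OF bounds(1)]]
                always_eventually[OF allI[OF bounds(2)]] tendsto_const])
      qed (intro g_nonneg path_continuous elim(1))+
      then show ?case using less_imp_le[OF A_before[of \<omega>]]
        by (cases "\<omega> \<in> ?A") (auto simp: max_absorb1 Limsup_const)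
    qed
  qed
  moreover have "(\<integral>\<^sup>+\<omega>\<in>?A. ?R (\<lambda>_. 0) \<omega> \<partial>M) \<le> limsup (\<lambda>n. \<integral>\<^sup>+\<omega>\<in>?A. reward D g X (\<sigma> \<omega>) (\<tau> n \<omega>) \<omega> \<partial>M)"
    using gain by (intro le_Limsup) auto
  ultimately have R_le: "(\<integral>\<^sup>+\<omega>\<in>?A. ?R (\<lambda>_. 0) \<omega> \<partial>M) \<le> (\<integral>\<^sup>+\<omega>\<in>?A. ?R ?\<eta> \<omega> \<partial>M)" by simp

  let ?now = "cond_reward \<sigma> (\<lambda>_. 0)" and ?cont = "cond_reward \<sigma> ?\<eta>"
  have to_cond: "(\<integral>\<^sup>+\<omega>\<in>?A. ?R \<tau> \<omega> \<partial>M) = (\<integral>\<^sup>+\<omega>\<in>?A. cond_reward \<sigma> \<tau> \<omega> \<partial>M)" if "stopping_time G \<tau>" for \<tau>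
    using cond_reward_integral[OF \<sigma> that, of "indicator ?A"] A by (simp add: mult.commute)
  have [measurable]: "cond_reward \<sigma> \<tau> \<in> borel_measurable M" for \<tau>
    by (rule measurable_from_subalg[OF subalgebra_pre_sigma[OF \<sigma>] cond_reward_measurable])
  have C_le: "AE \<omega> in M. ?cont \<omega> * indicator ?A \<omega> \<le> ?now \<omega> * indicator ?A \<omega>"
    using strict by eventually_elim (auto split: split_indicator dest: A_before)
  have fin: "(\<integral>\<^sup>+\<omega>\<in>?A. ?now \<omega> \<partial>M) < \<infinity>"
  proof -
    have "(\<integral>\<^sup>+\<omega>\<in>?A. ?now \<omega> \<partial>M) = (\<integral>\<^sup>+\<omega>\<in>?A. ?R (\<lambda>_. 0) \<omega> \<partial>M)"
      by (rule to_cond[OF stopping_time_const, symmetric])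
    also have "\<dots> \<le> (\<integral>\<^sup>+\<omega>. ennreal (1 / D ?N) * reward D g X 0 (\<sigma> \<omega>) \<omega> \<partial>M)"
      by (intro nn_integral_mono) (auto split: split_indicator intro!: reward_le_class_D A_N)
    also have "\<dots> = ennreal (1 / D ?N) * (\<integral>\<^sup>+\<omega>. reward D g X 0 (\<sigma> \<omega>) \<omega> \<partial>M)"
      by (intro nn_integral_cmult reward_measurable) auto
    also have "\<dots> < \<infinity>" using expected_reward_finite[OF \<sigma>] by (simp add: ennreal_mult_less_top)
    finally show ?thesis .
  qed
  have eq: "(\<integral>\<^sup>+\<omega>\<in>?A. ?now \<omega> \<partial>M) = (\<integral>\<^sup>+\<omega>\<in>?A. ?cont \<omega> \<partial>M)"
    using R_le nn_integral_mono_AE[OF C_le]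
    by (intro antisym) (simp_all only: to_cond[OF stopping_time_const] to_cond[OF naive_limit_stopping])
  \<comment> \<open>Equal finite integrals of ordered functions exclude a strict inequality on an event of positive probability.\<close>
  have "(\<integral>\<^sup>+\<omega>. ?now \<omega> * indicator ?A \<omega> - ?cont \<omega> * indicator ?A \<omega> \<partial>M) = 0"
    using fin eq by (subst nn_integral_diff[OF _ _ _ C_le]) auto
  then have "AE \<omega> in M. ?now \<omega> * indicator ?A \<omega> - ?cont \<omega> * indicator ?A \<omega> = 0"
    by (subst (asm) nn_integral_0_iff_AE) auto
  with strict have "AE \<omega> in M. \<omega> \<notin> ?A"
  proof eventually_elim
    case (elim \<omega>)
    show ?case
    proof
      assume \<omega>: "\<omega> \<in> ?A"
      have "?cont \<omega> < ?now \<omega>" using elim(1) A_before[OF \<omega>] by simp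
      moreover have "?now \<omega> - ?cont \<omega> = 0" using elim(2) \<omega> by simp
      ultimately show False by (auto simp: diff_eq_0_iff_ennreal)
    qed
  qed
  then show False using A_pos by simp
qed

section \<open>Essential bounds\<close>

text \<open>The stopping times above \<open>\<phi>\<close> are closed under countable infima, so the ordering principle provides one that
cannot be lowered on an event of positive probability. In particular no member of \<open>C\<close> lowers it; so it is a lower bound
of \<open>C\<close> and almost surely equal to \<open>\<phi>\<close>.\<close>

lemma ess_inf_stopping:
  assumes C: "\<And>\<tau>. \<tau> \<in> C \<Longrightarrow> stopping_time G \<tau>" and \<phi>: "is_ess_inf M C \<phi>"
  shows "stopping_time G \<phi>"
proof -
  have \<phi>M: "\<phi> \<in> borel_measurable M" and lower: "\<And>\<tau>. \<tau> \<in> C \<Longrightarrow> AE \<omega> in M. \<phi> \<omega> \<le> \<tau> \<omega>"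
    and greatest: "\<And>\<psi>. \<lbrakk>\<psi> \<in> borel_measurable M; \<And>\<tau>. \<tau> \<in> C \<Longrightarrow> AE \<omega> in M. \<psi> \<omega> \<le> \<tau> \<omega>\<rbrakk> \<Longrightarrow> AE \<omega> in M. \<psi> \<omega> \<le> \<phi> \<omega>"
    using \<phi> by (auto simp: is_ess_inf_def)
  let ?S = "{\<tau>. stopping_time G \<tau> \<and> (AE \<omega> in M. \<phi> \<omega> \<le> \<tau> \<omega>)}"
  obtain m where m: "m \<in> ?S"
    and min: "\<And>\<tau>. \<tau> \<in> ?S \<Longrightarrow> (\<forall>\<omega>. \<tau> \<omega> \<le> m \<omega>) \<Longrightarrow> earliness \<tau> = earliness m"
  proof (rule ordering_principle[where S="?S" and le="\<lambda>\<tau> \<tau>'. \<forall>\<omega>. \<tau>' \<omega> \<le> \<tau> \<omega>" and f=earliness and C=1 and ?x0.0="\<lambda>_. \<infinity>"])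
    show "\<exists>\<tau>\<in>?S. \<forall>k \<omega>. \<tau> \<omega> \<le> x k \<omega>" if "\<And>k. x k \<in> ?S" for x :: "nat \<Rightarrow> 'w \<Rightarrow> ennreal"
    proof (intro bexI allI)
      have "AE \<omega> in M. \<forall>k. \<phi> \<omega> \<le> x k \<omega>" using that by (simp add: AE_all_countable)
      then have "AE \<omega> in M. \<phi> \<omega> \<le> (INF k. x k \<omega>)" by eventually_elim (auto intro!: INF_greatest)
      then show "(\<lambda>\<omega>. INF k. x k \<omega>) \<in> ?S" using that by (auto intro!: stopping_time_INF)
    qed (auto intro!: INF_lower)
    show "(\<lambda>_. \<infinity>) \<in> ?S" by (simp add: stopping_time_const)
    show "\<forall>\<omega>. z \<omega> \<le> x \<omega>" if "\<forall>\<omega>. y \<omega> \<le> x \<omega>" "\<forall>\<omega>. z \<omega> \<le> y \<omega>" for x y z :: "'w \<Rightarrow> ennreal"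
      using that by (meson order_trans)
    show "earliness x \<le> earliness y" if "\<forall>\<omega>. y \<omega> \<le> x \<omega>" for x y
      using that by (intro earliness_antimono) auto
    show "earliness x \<le> 1" for x by (rule earliness_bounds)
    show "\<forall>\<omega>. x \<omega> \<le> x \<omega>" for x :: "'w \<Rightarrow> ennreal" by simp
  qed blast
  have "AE \<omega> in M. m \<omega> \<le> \<tau> \<omega>" if "\<tau> \<in> C" for \<tau>
  proof -
    let ?m = "\<lambda>\<omega>. min (m \<omega>) (\<tau> \<omega>)"
    have sm: "stopping_time G ?m" using m C[OF that] by (auto intro: stopping_time_min)
    have "AE \<omega> in M. \<phi> \<omega> \<le> ?m \<omega>" using m lower[OF that] by auto
    then have "earliness ?m = earliness m" using sm by (intro min) auto
    then have "AE \<omega> in M. m \<omega> = ?m \<omega>"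
      using m sm by (intro AE_eq_if_earliness_eq stopping_time_measurable) auto
    then show ?thesis by eventually_elim (metis min.cobounded2)
  qed
  then have "AE \<omega> in M. m \<omega> \<le> \<phi> \<omega>" using m by (intro greatest) (auto intro: stopping_time_measurable)
  then have "AE \<omega> in M. \<phi> \<omega> = m \<omega>" using m by (auto elim: eventually_elim2)
  from stopping_time_AE_eq[OF _ \<phi>M this] show ?thesis using m by blast
qed

lemma approachable_le_naive_limit:
  assumes "\<tau> \<in> approachable_times M G J"
  shows "AE \<omega> in M. \<tau> \<omega> \<le> naive_limit M G J \<omega>"
proof -
  have fixed: "AE \<omega> in M. F \<tau> \<omega> = \<tau> \<omega>" using assms by (simp add: approachable_times_def)
  have "AE \<omega> in M. \<tau> \<omega> \<le> naive_time M G J n \<omega>" for n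
  proof (induction n)
    case (Suc n)
    with fixed show ?case by eventually_elim (metis F_mono[OF Suc] naive_time.simps(2))
  qed simp
  then have "AE \<omega> in M. \<forall>n. \<tau> \<omega> \<le> naive_time M G J n \<omega>" by (simp add: AE_all_countable)
  then show ?thesis unfolding naive_limit_eq by eventually_elim (auto intro!: INF_greatest)
qed

lemma naive_limit_ess_sup: "is_ess_sup M (approachable_times M G J) (naive_limit M G J)"
  unfolding is_ess_sup_def
  using naive_limit_stopping naive_limit_approachable approachable_le_naive_limit
  by (auto simp: approachable_times_def all_stopping_times_eq stopping_time_measurable)

lemma naive_limit_lower_bound_admissible:
  "admissible M G J {\<rho>. stopping_time G \<rho> \<and> (AE \<omega> in M. naive_limit M G J \<omega> \<le> \<rho> \<omega>)}"
  (is "admissible M G J ?B")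
  unfolding admissible_def all_stopping_times_eq
proof (intro conjI ballI allI impI)
  show "?B \<subseteq> {\<tau>. stopping_time G \<tau>}" by auto
  show "(\<lambda>_. \<infinity>) \<in> ?B" by (simp add: stopping_time_const)
  fix \<rho> assume \<rho>: "\<rho> \<in> ?B"
  then have le: "AE \<omega> in M. naive_limit M G J \<omega> \<le> \<rho> \<omega>" by simp
  have "AE \<omega> in M. naive_limit M G J \<omega> \<le> F \<rho> \<omega>"
    using le naive_limit_approachable by eventually_elim (metis F_mono[OF le])
  then show "F \<rho> \<in> ?B" using \<rho> by (simp add: F_stopping)
next
  fix C \<phi>
  assume "C \<subseteq> ?B \<and> (\<forall>\<rho>\<in>C. \<forall>\<rho>'\<in>C. (AE \<omega> in M. \<rho> \<omega> \<le> \<rho>' \<omega>) \<or> (AE \<omega> in M. \<rho>' \<omega> \<le> \<rho> \<omega>)) \<and> is_ess_inf M C \<phi>"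
  then have C: "C \<subseteq> ?B" and \<phi>: "is_ess_inf M C \<phi>" by auto
  have "stopping_time G \<phi>" using C by (intro ess_inf_stopping[OF _ \<phi>]) auto
  moreover have "AE \<omega> in M. naive_limit M G J \<omega> \<le> \<phi> \<omega>"
    using \<phi> C stopping_time_measurable[OF naive_limit_stopping] by (auto simp: is_ess_inf_def)
  ultimately show "\<phi> \<in> ?B" by simp
qed

lemma naive_limit_in_admissible:
  assumes "admissible M G J \<B>"
  shows "naive_limit M G J \<in> \<B>"
proof -
  have naive: "naive_time M G J n \<in> \<B>" for n
    using assms by (induction n) (auto simp: admissible_def)
  let ?C = "range (naive_time M G J)"
  have "is_ess_inf M ?C (naive_limit M G J)"
    unfolding is_ess_inf_def
  proof (intro conjI ballI impI)
    fix \<psi> assume "\<forall>\<tau>\<in>?C. AE \<omega> in M. \<psi> \<omega> \<le> \<tau> \<omega>"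
    then have "AE \<omega> in M. \<forall>n. \<psi> \<omega> \<le> naive_time M G J n \<omega>" by (simp add: AE_all_countable)
    then show "AE \<omega> in M. \<psi> \<omega> \<le> naive_limit M G J \<omega>"
      unfolding naive_limit_eq by eventually_elim (auto intro!: INF_greatest)
  qed (auto simp: naive_limit_le stopping_time_measurable[OF naive_limit_stopping])
  moreover have "(AE \<omega> in M. \<rho> \<omega> \<le> \<rho>' \<omega>) \<or> (AE \<omega> in M. \<rho>' \<omega> \<le> \<rho> \<omega>)" if "\<rho> \<in> ?C" "\<rho>' \<in> ?C" for \<rho> \<rho>'
  proof -
    from that obtain i j where ij: "\<rho> = naive_time M G J i" "\<rho>' = naive_time M G J j" by blast
    show ?thesis
      using linear[of i j] unfolding ij by (auto intro!: AE_I2 decseqD[OF naive_decseq])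
  qed
  moreover have "?C \<subseteq> \<B>" using naive by auto
  ultimately show ?thesis using assms unfolding admissible_def by blast
qed

lemma naive_limit_ess_inf: "is_ess_inf M (least_admissible M G J) (naive_limit M G J)"
  unfolding is_ess_inf_def
proof (intro conjI ballI impI)
  show "naive_limit M G J \<in> borel_measurable M" by (rule stopping_time_measurable[OF naive_limit_stopping])
  show "AE \<omega> in M. naive_limit M G J \<omega> \<le> \<tau> \<omega>" if "\<tau> \<in> least_admissible M G J" for \<tau>
    using that naive_limit_lower_bound_admissible by (auto simp: least_admissible_def)
  have "naive_limit M G J \<in> least_admissible M G J"
    using naive_limit_in_admissible by (auto simp: least_admissible_def)
  then show "AE \<omega> in M. \<psi> \<omega> \<le> naive_limit M G J \<omega>"
    if "\<forall>\<tau>\<in>least_admissible M G J. AE \<omega> in M. \<psi> \<omega> \<le> \<tau> \<omega>" for \<psi>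
    using that by blast
qed

theorem naive_limit_eq_sophisticated:
  "AE \<omega> in M. naive_limit M G J \<omega> = tau_star M G J \<omega> \<and> tau_star M G J \<omega> = rho_star M G J \<omega>"
proof -
  have sup: "is_ess_sup M (approachable_times M G J) (tau_star M G J)"
    unfolding tau_star_def by (rule someI[where P="is_ess_sup M (approachable_times M G J)", OF naive_limit_ess_sup])
  have inf: "is_ess_inf M (least_admissible M G J) (rho_star M G J)"
    unfolding rho_star_def by (rule someI[where P="is_ess_inf M (least_admissible M G J)", OF naive_limit_ess_inf])
  show ?thesis
    using is_ess_sup_unique[OF naive_limit_ess_sup sup] is_ess_inf_unique[OF naive_limit_ess_inf inf]
    by eventually_elim auto
qed

end

section \<open>The augmented Brownian filtration\<close>

lemma aug_filtration_generators:
  "{B s -` A \<inter> space M | s A. 0 \<le> s \<and> ennreal s \<le> t \<and> A \<in> sets borel} \<union> null_sets M \<subseteq> Pow (space M)"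
  using sets.sets_into_space by fastforce

lemma space_aug_filtration: "space (aug_filtration M B t) = space M"
  unfolding aug_filtration_def using aug_filtration_generators by (rule space_measure_of)

lemma sets_aug_filtration:
  "sets (aug_filtration M B t) = sigma_sets (space M)
     ({B s -` A \<inter> space M | s A. 0 \<le> s \<and> ennreal s \<le> t \<and> A \<in> sets borel} \<union> null_sets M)"
  unfolding aug_filtration_def using aug_filtration_generators by (rule sets_measure_of)

lemma filtration_aug_filtration: "filtration (space M) (aug_filtration M B)"
proof
  fix s t :: ennreal assume "s \<le> t"
  then show "sets (aug_filtration M B s) \<subseteq> sets (aug_filtration M B t)"
    unfolding sets_aug_filtration by (intro sigma_sets_mono') (blast intro: order_trans)
qed (rule space_aug_filtration)

lemma sets_aug_filtration_le:
  assumes "\<And>s. 0 \<le> s \<Longrightarrow> B s \<in> borel_measurable M"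
  shows "sets (aug_filtration M B t) \<subseteq> sets M"
  unfolding sets_aug_filtration
  by (rule sets.sigma_sets_subset) (auto intro: measurable_sets[OF assms])

theorem theorem4p1:
  fixes M :: "'w measure"
    and B :: "real \<Rightarrow> 'w \<Rightarrow> real ^ 'm::finite"
    and G :: "ennreal \<Rightarrow> 'w measure"
    and b :: "real \<Rightarrow> real ^ 'd::finite \<Rightarrow> real ^ 'd"
    and \<sigma> :: "real \<Rightarrow> real ^ 'd \<Rightarrow> real ^ 'm ^ 'd"
    and x\<^sub>0 :: "real ^ 'd"
    and X :: "real \<Rightarrow> 'w \<Rightarrow> real ^ 'd"
    and D :: "real \<Rightarrow> real"
    and g :: "real ^ 'd \<Rightarrow> real"
    and J :: "('w \<Rightarrow> ennreal) \<Rightarrow> ennreal \<Rightarrow> 'w \<Rightarrow> ennreal"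
  assumes prob: "prob_space M"
    and brownian: "brownian_motion M B"
    and filtration: "G = aug_filtration M B"
    and usual: "usual_conditions M G"
    and b_borel: "(\<lambda>(s, x). b s x) \<in> borel_measurable (restrict_space borel {0..} \<Otimes>\<^sub>M borel)"
    and \<sigma>_borel: "(\<lambda>(s, x). \<sigma> s x) \<in> borel_measurable (restrict_space borel {0..} \<Otimes>\<^sub>M borel)"
    and sde: "unique_strong_solution M B b \<sigma> x\<^sub>0 X"
    and markov: "strongly_markovian M G X"
    and g_nonneg: "\<And>x. 0 \<le> g x"
    and g_cont: "continuous_on UNIV g"
    and D: "discount_function D"
    and D_impatience: "\<And>s t. 0 \<le> s \<Longrightarrow> 0 \<le> t \<Longrightarrow> D t * D s \<le> D (t + s)"
    and Y_class_D: "class_D M G (reward D g X 0)"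
    and J: "coherent_versions M G D g X J"
  shows "AE \<omega> in M. naive_limit M G J \<omega> = tau_star M G J \<omega> \<and> tau_star M G J \<omega> = rho_star M G J \<omega>"
proof -
  interpret prob_space M by (rule prob)
  interpret filtration "space M" G
    unfolding filtration by (rule filtration_aug_filtration)
  have sets_le: "sets (G t) \<subseteq> sets M" for t
    unfolding filtration using brownian by (intro sets_aug_filtration_le) (simp add: brownian_motion_def)
  have X: "X t \<in> borel_measurable (G (ennreal t))" if "0 \<le> t" for t
    using sde that by (simp add: unique_strong_solution_def strong_solution_def filtration)
  have X_cont: "continuous_on {0..} (\<lambda>t. X t \<omega>)" if "\<omega> \<in> space M" for \<omega>
    using sde that by (simp add: unique_strong_solution_def strong_solution_def)
  interpret stopping_problem M G D g X J
  proof
    show "(\<lambda>\<omega>. g (X t \<omega>)) \<in> borel_measurable M" if "0 \<le> t" for t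
    proof -
      have "X t \<in> borel_measurable M"
        using X[OF that] sets_le by (intro measurable_from_subalg[of M "G (ennreal t)"]) (auto simp: subalgebra_def space_F)
      then show ?thesis
        by (rule measurable_compose[OF _ borel_measurable_continuous_onI[OF g_cont]])
    qed
    show "continuous_on {0..} (\<lambda>t. g (X t \<omega>))" if "\<omega> \<in> space M" for \<omega>
      by (rule continuous_on_compose2[OF g_cont X_cont[OF that]]) simp
  qed (rule sets_le usual g_nonneg D D_impatience Y_class_D J; assumption)+
  show ?thesis by (rule naive_limit_eq_sophisticated)
qed

end
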